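(* Let $\ell_1,\ell_2>0$. The singular curves of the distribution ${\mathcal D}$ in ${\mathcal C}$ are the integral curves of the vector field $$\xi=\left(\frac{\sin\alpha_1}{\ell_1}-\frac{\sin\alpha_2}{\ell_2}\right)v_1-\left(\frac{\cos\alpha_1}{\ell_1}-\frac{\cos\alpha_2}{\ell_2}\right)v_2,$$ where $$v_1=\partial_{x_1}-\frac{\sin\alpha_1}{\ell_1}\partial_{\alpha_1}-\frac{\sin\alpha_2}{\ell_2}\partial_{\alpha_2},\qquad v_2=\partial_{x_2}+\frac{\cos\alpha_1}{\ell_1}\partial_{\alpha_1}+\frac{\cos\alpha_2}{\ell_2}\partial_{\alpha_2}.$$
   Context: 2-linkage: a triple of points $x,m_1,m_2\in\mathbb{R}^2$ with $|xm_1|=\ell_1$, $|xm_2|=\ell_2$ fixed. Coordinates: $x=(x_1,x_2)$ and the directions $\alpha_1,\alpha_2\in\mathbb{R}/2\pi\mathbb{Z}$ of the oriented segments $m_1x$, $m_2x$, so $m_i=x-\ell_i(\cos\alpha_i,\sin\alpha_i)$. The configuration space ${\mathcal C}$ is $\mathbb{R}^2\times T^2$ with the locus $m_1=m_2$ removed (so $\alpha_1\neq\alpha_2$ if $\ell_1=\ell_2$). The 2-dimensional distribution ${\mathcal D}$ on ${\mathcal C}$ expresses the no-slip condition that the velocity of $m_i$ is parallel to the segment $m_ix$, $i=1,2$; equivalently ${\mathcal D}$ is spanned by $v_1,v_2$. A horizontal curve is a curve tangent to ${\mathcal D}$. Singular curves are the (regular) horizontal curves that are singular points of the space of horizontal paths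 connecting two fixed points, i.e. critical points of the endpoint map; curves are considered up to reparametrization. Since ${\mathcal D}$ has growth vector $(2,3,4)$ (an Engel structure), it is a known fact that ${\mathcal C}$ is foliated by singular curves, which are tangent to the line field in ${\mathcal D}$ spanned by horizontal fields $\xi$ with $[\xi,{\mathcal D}^2]\subset{\mathcal D}^2$, where ${\mathcal D}^2={\mathcal D}+[{\mathcal D},{\mathcal D}]$. *)

theory Defs
  imports "HOL-Analysis.Analysis"
begin

text \<open>
  The plane is identified with \<^typ>\<open>complex\<close>, and a direction
  \<open>\<alpha> \<in> \<real>/2\<pi>\<int>\<close> is represented by the unit complex number \<open>cis \<alpha>\<close>.  A configuration
  is \<open>(x, cis \<alpha>\<^sub>1, cis \<alpha>\<^sub>2)\<close>, so \<open>\<real>\<^sup>2 \<times> T\<^sup>2\<close> is the submanifold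
  \<open>UNIV \<times> sphere 0 1 \<times> sphere 0 1\<close> of \<open>\<complex>\<^sup>3\<close>.
\<close>

type_synonym config = "complex \<times> complex \<times> complex"

abbreviation pos :: "config \<Rightarrow> complex" where "pos q \<equiv> fst q"
abbreviation dir1 :: "config \<Rightarrow> complex" where "dir1 q \<equiv> fst (snd q)"
abbreviation dir2 :: "config \<Rightarrow> complex" where "dir2 q \<equiv> snd (snd q)"

abbreviation cos\<alpha>1 :: "config \<Rightarrow> real" where "cos\<alpha>1 q \<equiv> Re (dir1 q)"
abbreviation sin\<alpha>1 :: "config \<Rightarrow> real" where "sin\<alpha>1 q \<equiv> Im (dir1 q)"
abbreviation cos\<alpha>2 :: "config \<Rightarrow> real" where "cos\<alpha>2 q \<equiv> Re (dir2 q)"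
abbreviation sin\<alpha>2 :: "config \<Rightarrow> real" where "sin\<alpha>2 q \<equiv> Im (dir2 q)"

definition m1 :: "real \<Rightarrow> config \<Rightarrow> complex" where
  "m1 l1 q = pos q - l1 *\<^sub>R dir1 q"

definition m2 :: "real \<Rightarrow> config \<Rightarrow> complex" where
  "m2 l2 q = pos q - l2 *\<^sub>R dir2 q"

definition config_space :: "real \<Rightarrow> real \<Rightarrow> config set" where
  "config_space l1 l2 =
     {q \<in> UNIV \<times> sphere 0 1 \<times> sphere 0 1. m1 l1 q \<noteq> m2 l2 q}"

definition d_x1 :: "config \<Rightarrow> config" where "d_x1 q = (1, 0, 0)"
definition d_x2 :: "config \<Rightarrow> config" where "d_x2 q = (\<i>, 0, 0)"
definition d_\<alpha>1 :: "config \<Rightarrow> config" where "d_\<alpha>1 q = (0, \<i> * dir1 q, 0)"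
definition d_\<alpha>2 :: "config \<Rightarrow> config" where "d_\<alpha>2 q = (0, 0, \<i> * dir2 q)"

lemma coordinate_fields:
  "((\<lambda>s. (Complex s y, z1, z2)) has_vector_derivative d_x1 (Complex x y, z1, z2)) (at x)"
  "((\<lambda>s. (Complex x s, z1, z2)) has_vector_derivative d_x2 (Complex x y, z1, z2)) (at y)"
  "((\<lambda>s. (p, cis s, z2)) has_vector_derivative d_\<alpha>1 (p, cis \<alpha>, z2)) (at \<alpha>)"
  "((\<lambda>s. (p, z1, cis s)) has_vector_derivative d_\<alpha>2 (p, z1, cis \<alpha>)) (at \<alpha>)"
proof -
  have c: "(cis has_vector_derivative \<i> * cis a) (at a)" for a
    using has_derivative_cis[OF has_derivative_ident, of a UNIV]
    by (simp add: has_vector_derivative_def)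
  have 1: "((\<lambda>s. Complex s y) has_vector_derivative 1) (at x)"
    unfolding has_vector_derivative_complex_iff by (auto intro!: derivative_eq_intros)
  have 2: "((\<lambda>s. Complex x s) has_vector_derivative \<i>) (at y)"
    unfolding has_vector_derivative_complex_iff by (auto intro!: derivative_eq_intros)
  show "((\<lambda>s. (Complex s y, z1, z2)) has_vector_derivative d_x1 (Complex x y, z1, z2)) (at x)"
    "((\<lambda>s. (Complex x s, z1, z2)) has_vector_derivative d_x2 (Complex x y, z1, z2)) (at y)"
    "((\<lambda>s. (p, cis s, z2)) has_vector_derivative d_\<alpha>1 (p, cis \<alpha>, z2)) (at \<alpha>)"
    "((\<lambda>s. (p, z1, cis s)) has_vector_derivative d_\<alpha>2 (p, z1, cis \<alpha>)) (at \<alpha>)"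
    unfolding d_x1_def d_x2_def d_\<alpha>1_def d_\<alpha>2_def
    using 1 2 c[of \<alpha>] by (auto intro!: has_vector_derivative_Pair)
qed

definition tangent_space :: "config \<Rightarrow> config set" where
  "tangent_space q = span {d_x1 q, d_x2 q, d_\<alpha>1 q, d_\<alpha>2 q}"

text \<open>No-slip: the velocity of \<open>m\<^sub>i\<close> is parallel to the segment \<open>m\<^sub>ix\<close>.\<close>

definition distribution :: "real \<Rightarrow> real \<Rightarrow> config \<Rightarrow> config set" where
  "distribution l1 l2 q =
     {w \<in> tangent_space q.
        (\<exists>c::real. frechet_derivative (m1 l1) (at q) w = c *\<^sub>R (pos q - m1 l1 q)) \<and>
        (\<exists>c::real. frechet_derivative (m2 l2) (at q) w = c *\<^sub>R (pos q - m2 l2 q))}"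

definition v1 :: "real \<Rightarrow> real \<Rightarrow> config \<Rightarrow> config" where
  "v1 l1 l2 q = d_x1 q - (sin\<alpha>1 q / l1) *\<^sub>R d_\<alpha>1 q - (sin\<alpha>2 q / l2) *\<^sub>R d_\<alpha>2 q"

definition v2 :: "real \<Rightarrow> real \<Rightarrow> config \<Rightarrow> config" where
  "v2 l1 l2 q = d_x2 q + (cos\<alpha>1 q / l1) *\<^sub>R d_\<alpha>1 q + (cos\<alpha>2 q / l2) *\<^sub>R d_\<alpha>2 q"

definition xi :: "real \<Rightarrow> real \<Rightarrow> config \<Rightarrow> config" where
  "xi l1 l2 q =
     (sin\<alpha>1 q / l1 - sin\<alpha>2 q / l2) *\<^sub>R v1 l1 l2 q
     - (cos\<alpha>1 q / l1 - cos\<alpha>2 q / l2) *\<^sub>R v2 l1 l2 q"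

lemma no_slip_iff:
  fixes w z :: complex and l r :: real
  assumes "l > 0" "norm z = 1"
  shows "(\<exists>c::real. w - l *\<^sub>R (r *\<^sub>R (\<i> * z)) = c *\<^sub>R (l *\<^sub>R z))
           \<longleftrightarrow> r = (Im w * Re z - Re w * Im z) / l"
proof -
  have n: "Re z * Re z + Im z * Im z = 1"
    using assms(2) by (metis cmod_power2 power2_eq_square one_power2)
  show ?thesis
  proof
    assume "\<exists>c::real. w - l *\<^sub>R (r *\<^sub>R (\<i> * z)) = c *\<^sub>R (l *\<^sub>R z)"
    then obtain c :: real where "w = l *\<^sub>R (r *\<^sub>R (\<i> * z)) + c *\<^sub>R (l *\<^sub>R z)"
      by (auto simp: algebra_simps)
    then have "Im w * Re z - Re w * Im z = l * r * (Re z * Re z + Im z * Im z)"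
      by (simp add: algebra_simps)
    then show "r = (Im w * Re z - Re w * Im z) / l"
      using n assms(1) by simp
  next
    assume r: "r = (Im w * Re z - Re w * Im z) / l"
    let ?c = "(Re w * Re z + Im w * Im z) / l"
    have rl: "l * r = Im w * Re z - Re w * Im z" and
      cl: "?c * l = Re w * Re z + Im w * Im z"
      using r assms(1) by simp_all
    have "Re w + (l * r) * Im z - (?c * l) * Re z = Re w * (1 - (Re z * Re z + Im z * Im z))"
      "Im w - (l * r) * Re z - (?c * l) * Im z = Im w * (1 - (Re z * Re z + Im z * Im z))"
      unfolding rl cl by (simp_all add: algebra_simps)
    then have "w - l *\<^sub>R (r *\<^sub>R (\<i> * z)) = ?c *\<^sub>R (l *\<^sub>R z)"
      using n by (intro complex_eqI) (simp_all add: mult.assoc)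
    then show "\<exists>c::real. w - l *\<^sub>R (r *\<^sub>R (\<i> * z)) = c *\<^sub>R (l *\<^sub>R z)" by blast
  qed
qed

lemma distribution_eq_span:
  assumes "l1 > 0" "l2 > 0" "q \<in> config_space l1 l2"
  shows "distribution l1 l2 q = span {v1 l1 l2 q, v2 l1 l2 q}"
proof -
  obtain x z1 z2 where q: "q = (x, z1, z2)" by (cases q)
  have n: "norm z1 = 1" "norm z2 = 1"
    using assms(3) by (auto simp: config_space_def q)
  have "(m1 l1 has_derivative (\<lambda>w. fst w - l1 *\<^sub>R fst (snd w))) (at q)"
    "(m2 l2 has_derivative (\<lambda>w. fst w - l2 *\<^sub>R snd (snd w))) (at q)"
    unfolding m1_def[abs_def] m2_def[abs_def] by (auto intro!: derivative_eq_intros)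
  then have fd: "frechet_derivative (m1 l1) (at q) = (\<lambda>w. fst w - l1 *\<^sub>R fst (snd w))"
    "frechet_derivative (m2 l2) (at q) = (\<lambda>w. fst w - l2 *\<^sub>R snd (snd w))"
    by (metis frechet_derivative_at)+
  have ts: "w \<in> tangent_space q \<longleftrightarrow>
      (\<exists>p r1 r2. w = (p, r1 *\<^sub>R (\<i> * z1), r2 *\<^sub>R (\<i> * z2)))" for w
  proof -
    have "w \<in> tangent_space q \<longleftrightarrow> (\<exists>a b r1 r2. w - a *\<^sub>R d_x1 q - b *\<^sub>R d_x2 q
        - r1 *\<^sub>R d_\<alpha>1 q - r2 *\<^sub>R d_\<alpha>2 q = 0)"
      unfolding tangent_space_def span_insert by (simp add: algebra_simps)
    also have "\<dots> \<longleftrightarrow> (\<exists>a b r1 r2. w = (Complex a b, r1 *\<^sub>R (\<i> * z1), r2 *\<^sub>R (\<i> * z2)))"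
      by (cases w) (simp add: d_x1_def d_x2_def d_\<alpha>1_def d_\<alpha>2_def q zero_prod_def
          complex_eq_iff algebra_simps eq_neg_iff_add_eq_0)
    also have "\<dots> \<longleftrightarrow> (\<exists>p r1 r2. w = (p, r1 *\<^sub>R (\<i> * z1), r2 *\<^sub>R (\<i> * z2)))"
      by (metis complex.collapse)
    finally show ?thesis .
  qed
  have D: "w \<in> distribution l1 l2 q \<longleftrightarrow>
      (\<exists>p. w = (p, ((Im p * Re z1 - Re p * Im z1) / l1) *\<^sub>R (\<i> * z1),
                ((Im p * Re z2 - Re p * Im z2) / l2) *\<^sub>R (\<i> * z2)))" for w
  proof -
    have "w \<in> distribution l1 l2 q \<longleftrightarrow>
      (\<exists>p r1 r2. w = (p, r1 *\<^sub>R (\<i> * z1), r2 *\<^sub>R (\<i> * z2)) \<and>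
        (\<exists>c::real. p - l1 *\<^sub>R (r1 *\<^sub>R (\<i> * z1)) = c *\<^sub>R (l1 *\<^sub>R z1)) \<and>
        (\<exists>c::real. p - l2 *\<^sub>R (r2 *\<^sub>R (\<i> * z2)) = c *\<^sub>R (l2 *\<^sub>R z2)))"
      unfolding distribution_def fd mem_Collect_eq ts
      by (auto simp add: m1_def m2_def q simp del: scaleR_scaleR scaleR_cancel_left scaleR_cancel_right) blast+
    then show ?thesis
      unfolding no_slip_iff[OF assms(1) n(1)] no_slip_iff[OF assms(2) n(2)] by blast
  qed
  have S: "w \<in> span {v1 l1 l2 q, v2 l1 l2 q} \<longleftrightarrow>
      (\<exists>a b. w = a *\<^sub>R v1 l1 l2 q + b *\<^sub>R v2 l1 l2 q)" for w
    unfolding span_insert by (simp add: algebra_simps)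
  have V: "a *\<^sub>R v1 l1 l2 q + b *\<^sub>R v2 l1 l2 q
      = (Complex a b, ((b * Re z1 - a * Im z1) / l1) *\<^sub>R (\<i> * z1),
         ((b * Re z2 - a * Im z2) / l2) *\<^sub>R (\<i> * z2))" for a b
    by (simp add: v1_def v2_def d_x1_def d_x2_def d_\<alpha>1_def d_\<alpha>2_def q complex_eq_iff
        diff_divide_distrib algebra_simps)
  show ?thesis
    unfolding set_eq_iff D S V
    by (metis complex.sel complex.collapse)
qed

text \<open>
  Curves are of class \<open>C\<^sup>1\<close> on a compact interval, with one-sided derivatives at the ends;
  \<^emph>\<open>regular\<close> means that the velocity does not vanish.
\<close>

definition regular_horizontal_curve ::
  "real \<Rightarrow> real \<Rightarrow> real \<Rightarrow> real \<Rightarrow> (real \<Rightarrow> config) \<Rightarrow> bool" where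
  "regular_horizontal_curve l1 l2 a b \<gamma> \<longleftrightarrow>
     (\<exists>\<gamma>'. continuous_on {a..b} \<gamma>' \<and>
        (\<forall>t\<in>{a..b}. \<gamma> t \<in> config_space l1 l2 \<and>
           (\<gamma> has_vector_derivative \<gamma>' t) (at t within {a..b}) \<and>
           \<gamma>' t \<in> distribution l1 l2 (\<gamma> t) \<and> \<gamma>' t \<noteq> 0))"

text \<open>
  Since \<open>v\<^sub>1, v\<^sub>2\<close> is a global frame of the distribution, the horizontal \<open>C\<^sup>1\<close> paths on
  \<open>[a, b]\<close> with a given starting point are parametrized by their velocity components
  \<open>u = (u\<^sub>1, u\<^sub>2)\<close> in that frame.  The Banach space of bounded continuous functions on the
  whole line serves as the space of controls; only \<open>u\<close> on \<open>[a, b]\<close> matters, and restriction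
  to \<open>[a, b]\<close> maps it onto \<open>C[a, b]\<close>.
\<close>

type_synonym control = "real \<Rightarrow>\<^sub>C (real \<times> real)"

definition trajectory ::
  "real \<Rightarrow> real \<Rightarrow> real \<Rightarrow> real \<Rightarrow> control \<Rightarrow> (real \<Rightarrow> config) \<Rightarrow> bool" where
  "trajectory l1 l2 a b u \<gamma> \<longleftrightarrow>
     (\<forall>t\<in>{a..b}. \<gamma> t \<in> config_space l1 l2 \<and>
        (\<gamma> has_vector_derivative
           fst (apply_bcontfun u t) *\<^sub>R v1 l1 l2 (\<gamma> t)
           + snd (apply_bcontfun u t) *\<^sub>R v2 l1 l2 (\<gamma> t)) (at t within {a..b}))"

definition endpoint_map ::
  "real \<Rightarrow> real \<Rightarrow> real \<Rightarrow> real \<Rightarrow> config \<Rightarrow> control \<Rightarrow> config" where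
  "endpoint_map l1 l2 a b q0 u =
     (THE q. \<exists>\<gamma>. trajectory l1 l2 a b u \<gamma> \<and> \<gamma> a = q0 \<and> \<gamma> b = q)"

text \<open>
  The endpoint map is critical where its differential is not onto the tangent space of the
  configuration space (not of the ambient \<open>\<complex>\<^sup>3\<close>).
\<close>

definition singular_curve ::
  "real \<Rightarrow> real \<Rightarrow> real \<Rightarrow> real \<Rightarrow> (real \<Rightarrow> config) \<Rightarrow> bool" where
  "singular_curve l1 l2 a b \<gamma> \<longleftrightarrow>
     regular_horizontal_curve l1 l2 a b \<gamma> \<and>
     (\<exists>u. trajectory l1 l2 a b u \<gamma> \<and>
        (\<exists>E. (endpoint_map l1 l2 a b (\<gamma> a) has_derivative E) (at u) \<and>
             range E \<noteq> tangent_space (\<gamma> b)))"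

definition integral_curve ::
  "(config \<Rightarrow> config) \<Rightarrow> config set \<Rightarrow> real \<Rightarrow> real \<Rightarrow> (real \<Rightarrow> config) \<Rightarrow> bool" where
  "integral_curve X S c d \<sigma> \<longleftrightarrow>
     (\<forall>t\<in>{c..d}. \<sigma> t \<in> S \<and> (\<sigma> has_vector_derivative X (\<sigma> t)) (at t within {c..d}))"

text \<open>Reparametrizations may reverse the orientation.\<close>

definition reparametrization ::
  "real \<Rightarrow> real \<Rightarrow> (real \<Rightarrow> config) \<Rightarrow> real \<Rightarrow> real \<Rightarrow> (real \<Rightarrow> config) \<Rightarrow> bool" where
  "reparametrization a b \<gamma> c d \<sigma> \<longleftrightarrow>
     (\<exists>\<phi> \<phi>'. continuous_on {a..b} \<phi>' \<and> \<phi> ` {a..b} = {c..d} \<and>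
        (\<forall>t\<in>{a..b}. (\<phi> has_real_derivative \<phi>' t) (at t within {a..b}) \<and>
           \<phi>' t \<noteq> 0 \<and> \<gamma> t = \<sigma> (\<phi> t)))"

end

theory Submission
  imports Defs
begin

text \<open>
  Write \<open>u\<close> for the velocity of \<open>x\<close> as a complex number and \<open>z\<^sub>1, z\<^sub>2\<close> for the unit vectors \<open>cis \<alpha>\<^sub>i\<close>.  The
  no-slip condition says \<open>z\<^sub>i' = \<i> z\<^sub>i Im (cnj z\<^sub>i u) / l\<^sub>i\<close>, so the two rods are towed by \<open>x\<close> independently
  of each other.  Let \<open>g\<^sub>i\<close> solve \<open>g\<^sub>i' = g\<^sub>i Re (cnj z\<^sub>i u) / l\<^sub>i\<close> with \<open>g\<^sub>i a = 1\<close>.  It is an integrating factor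
  for the linearized equation: a variation \<open>h\<close> of \<open>u\<close> changes the final direction to first order by
  \<open>\<i> z\<^sub>i(b) / g\<^sub>i(b)\<close> times the integral of \<open>g\<^sub>i Im (cnj z\<^sub>i h) / l\<^sub>i\<close> (\<open>towed_expansion\<close>).  Together with the
  integral of \<open>h\<close>, which is the change of the final position, this is the Frechet derivative of the
  endpoint map (\<open>endpoint_map_has_derivative\<close>).

  The derivative fails to be onto if and only if some nonzero covector \<open>(p, \<mu>\<^sub>1, \<mu>\<^sub>2)\<close> annihilates its range,
  which means that
  \<open>p + \<i> (\<mu>\<^sub>1 g\<^sub>1 z\<^sub>1 / l\<^sub>1 + \<mu>\<^sub>2 g\<^sub>2 z\<^sub>2 / l\<^sub>2) = 0\<close> at every time (\<open>derivative_not_onto_iff\<close>).  The key identity is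
  \<open>(g\<^sub>i z\<^sub>i)' = g\<^sub>i u / l\<^sub>i\<close> (\<open>towing_weight_direction\<close>).  Differentiating the covector equation and dividing by
  \<open>u \<noteq> 0\<close> gives \<open>\<mu>\<^sub>1 g\<^sub>1 / l\<^sub>1\<^sup>2 + \<mu>\<^sub>2 g\<^sub>2 / l\<^sub>2\<^sup>2 = 0\<close>, and differentiating once more gives
  \<open>Re (cnj z\<^sub>1 u) / l\<^sub>1 = Re (cnj z\<^sub>2 u) / l\<^sub>2\<close>.  Conversely this equality forces \<open>g\<^sub>1 = g\<^sub>2\<close>, hence
  \<open>l\<^sub>1 g\<^sub>1 z\<^sub>1 - l\<^sub>2 g\<^sub>2 z\<^sub>2\<close> has derivative zero and a covector exists (\<open>covector_iff_balanced\<close>).  The equality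
  says that \<open>u\<close> is orthogonal to \<open>z\<^sub>1 / l\<^sub>1 - z\<^sub>2 / l\<^sub>2\<close>, which means that \<open>u\<close> is a real multiple of the velocity of
  \<open>x\<close> along \<open>\<xi>\<close> (\<open>balanced_iff_parallel\<close>).  A change of time turns such a curve into an integral curve
  of \<open>\<xi>\<close> (\<open>reparametrized_integral_curve\<close>).
\<close>

section \<open>Ordinary differential equations on a compact interval\<close>

text \<open>
  Controls live on the whole line although only their restriction to \<open>[a, b]\<close> acts.  Freezing a
  function at its end values makes every continuous function on \<open>[a, b]\<close> available as a control.
\<close>

lemma continuous_on_bcontfun_extension:
  fixes f :: "real \<Rightarrow> 'a::metric_space"
  assumes "continuous_on {a..b} f"
  obtains g :: "real \<Rightarrow>\<^sub>C 'a" where "\<And>t. t \<in> {a..b} \<Longrightarrow> apply_bcontfun g t = f t"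
    and "\<And>t. apply_bcontfun g t = f (clamp a b t)"
  using continuous_on_cbox_bcontfunE[of a b f] assms by (metis box_real(2))

text \<open>
  A right-hand side that is Lipschitz on the whole space has solutions up to time \<open>b\<close>, without any
  restriction on the length of the interval.  One application of the contraction principle suffices
  if the unknown is divided by \<open>exp (M (t - a))\<close> with \<open>M\<close> at least twice the Lipschitz constant: in
  these variables the Picard operator contracts by the factor \<open>1/2\<close>.
\<close>

lemma picard_lindelof:
  fixes f :: "real \<Rightarrow> 'a::banach \<Rightarrow> 'a"
  assumes ab: "a \<le> b"
    and cont: "\<And>y. continuous_on {a..b} y \<Longrightarrow> continuous_on {a..b} (\<lambda>t. f t (y t))"
    and lip: "\<And>t x y. t \<in> {a..b} \<Longrightarrow> norm (f t x - f t y) \<le> L * norm (x - y)"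
  obtains y where "y a = x0"
    and "\<And>t. t \<in> {a..b} \<Longrightarrow> (y has_vector_derivative f t (y t)) (at t within {a..b})"
proof -
  define M where "M = 2 * max L 1"
  have M: "M > 0" "L \<le> M / 2"
    by (auto simp: M_def)
  define e where "e t = exp (M * (t - a))" for t
  have e_pos: "e t > 0" for t
    by (simp add: e_def)
  have e_cont [continuous_intros]: "continuous_on S e" for S
    unfolding e_def by (intro continuous_intros)
  have e_deriv: "((\<lambda>t. e t / M) has_vector_derivative e t) (at t within S)" for t S
    using M unfolding e_def has_real_derivative_iff_has_vector_derivative[symmetric]
    by (auto intro!: derivative_eq_intros)
  define P where "P \<beta> t = x0 + integral {a..t} (\<lambda>s. f s (e s *\<^sub>R apply_bcontfun \<beta> s))"
    for \<beta> :: "real \<Rightarrow>\<^sub>C 'a" and t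
  have f_cont: "continuous_on {a..b} (\<lambda>s. f s (e s *\<^sub>R apply_bcontfun \<beta> s))" for \<beta>
    by (intro cont continuous_intros) auto
  have P_deriv: "(P \<beta> has_vector_derivative f t (e t *\<^sub>R apply_bcontfun \<beta> t)) (at t within {a..b})"
    if "t \<in> {a..b}" for \<beta> t
    unfolding P_def using integral_has_vector_derivative[OF f_cont that]
    by (auto intro!: derivative_eq_intros)
  have P_cont: "continuous_on {a..b} (P \<beta>)" for \<beta>
    using P_deriv has_vector_derivative_continuous
    by (metis continuous_on_eq_continuous_within)
  \<comment> \<open>The unknown of the fixed-point equation is \<open>\<beta> = y / e\<close>, continued constantly outside \<open>[a, b]\<close> in
    order to work in the complete space of bounded continuous functions on the line.\<close>
  have "\<exists>\<beta>'. \<forall>t. apply_bcontfun \<beta>' t = P \<beta> (clamp a b t) /\<^sub>R e (clamp a b t)" for \<beta>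
  proof -
    have "continuous_on {a..b} (\<lambda>t. P \<beta> t /\<^sub>R e t)"
      using e_pos by (intro continuous_intros P_cont) (auto simp: less_le)
    from continuous_on_bcontfun_extension[OF this] show ?thesis
      by metis
  qed
  then obtain \<Phi> where \<Phi>: "apply_bcontfun (\<Phi> \<beta>) t = P \<beta> (clamp a b t) /\<^sub>R e (clamp a b t)"
    for \<beta> and t :: real
    by metis
  have contraction: "dist (\<Phi> \<beta>1) (\<Phi> \<beta>2) \<le> 1 / 2 * dist \<beta>1 \<beta>2" for \<beta>1 \<beta>2
  proof (rule dist_bound)
    fix t' :: real
    define t where "t = clamp a b t'"
    have t: "t \<in> {a..b}"
      unfolding t_def using clamp_in_interval[of a b t'] ab by (simp add: cbox_interval)
    have c: "continuous_on {a..t} (\<lambda>s. f s (e s *\<^sub>R apply_bcontfun \<beta> s))" for \<beta>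
      by (rule continuous_on_subset[OF f_cont]) (use t in auto)
    have ge: "((\<lambda>s. e s) has_integral (e t / M - e a / M)) {a..t}"
      by (rule fundamental_theorem_of_calculus) (use t e_deriv in auto)
    define d where "d = dist \<beta>1 \<beta>2"
    have d: "norm (apply_bcontfun \<beta>1 s - apply_bcontfun \<beta>2 s) \<le> d" for s
      unfolding d_def dist_norm[symmetric] by (rule dist_bounded)
    have "d \<ge> 0" by (simp add: d_def)
    have "norm (P \<beta>1 t - P \<beta>2 t)
      = norm (integral {a..t} (\<lambda>s. f s (e s *\<^sub>R apply_bcontfun \<beta>1 s) - f s (e s *\<^sub>R apply_bcontfun \<beta>2 s)))"
      unfolding P_def by (subst integral_diff) (auto intro: integrable_continuous_interval c)
    also have "\<dots> \<le> integral {a..t} (\<lambda>s. M / 2 * d * e s)"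
    proof (rule integral_norm_bound_integral)
      show "(\<lambda>s. M / 2 * d * e s) integrable_on {a..t}"
        using integrable_continuous_interval[OF continuous_on_mult_left[OF e_cont]] .
      fix s assume s: "s \<in> {a..t}"
      have "norm (f s (e s *\<^sub>R apply_bcontfun \<beta>1 s) - f s (e s *\<^sub>R apply_bcontfun \<beta>2 s))
        \<le> L * norm (e s *\<^sub>R apply_bcontfun \<beta>1 s - e s *\<^sub>R apply_bcontfun \<beta>2 s)"
        using lip s t by auto
      also have "\<dots> \<le> M / 2 * norm (e s *\<^sub>R apply_bcontfun \<beta>1 s - e s *\<^sub>R apply_bcontfun \<beta>2 s)"
        by (intro mult_right_mono M) auto
      also have "\<dots> = M / 2 * (e s * norm (apply_bcontfun \<beta>1 s - apply_bcontfun \<beta>2 s))"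
        using e_pos[of s] by (simp add: scaleR_diff_right[symmetric])
      also have "\<dots> \<le> M / 2 * (e s * d)"
        using M e_pos[of s] d by (intro mult_left_mono) auto
      finally show "norm (f s (e s *\<^sub>R apply_bcontfun \<beta>1 s) - f s (e s *\<^sub>R apply_bcontfun \<beta>2 s))
        \<le> M / 2 * d * e s"
        by (simp add: mult_ac)
    qed (auto intro!: integrable_continuous_interval continuous_intros c)
    also have "\<dots> = M / 2 * d * (e t / M - e a / M)"
      using ge by (simp add: integral_unique)
    also have "\<dots> \<le> M / 2 * d * (e t / M)"
      using M e_pos[of a] \<open>d \<ge> 0\<close> by (intro mult_left_mono) auto
    also have "\<dots> = e t * (1 / 2 * d)"
      using M by simp
    finally have bd: "norm (P \<beta>1 t - P \<beta>2 t) / e t \<le> 1 / 2 * d"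
      using e_pos[of t] by (simp add: divide_le_eq mult_ac)
    show "dist (apply_bcontfun (\<Phi> \<beta>1) t') (apply_bcontfun (\<Phi> \<beta>2) t') \<le> 1 / 2 * dist \<beta>1 \<beta>2"
    proof -
      have "dist (apply_bcontfun (\<Phi> \<beta>1) t') (apply_bcontfun (\<Phi> \<beta>2) t')
        = norm (P \<beta>1 t /\<^sub>R e t - P \<beta>2 t /\<^sub>R e t)"
        by (simp only: \<Phi> t_def dist_norm)
      also have "\<dots> = norm (P \<beta>1 t - P \<beta>2 t) / e t"
        using e_pos[of t] by (simp add: scaleR_diff_right[symmetric] divide_inverse_commute del: scaleR_diff_right)
      finally show ?thesis
        using bd by (simp only: d_def)
    qed
  qed
  obtain \<beta> where fp: "\<Phi> \<beta> = \<beta>"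
  proof -
    have "\<exists>!\<beta>. \<Phi> \<beta> = \<beta>"
      by (rule banach_fix_type[of "1/2"]) (use contraction in \<open>simp_all\<close>)
    then show ?thesis using that by blast
  qed
  have P_eq: "P \<beta> t = e t *\<^sub>R apply_bcontfun \<beta> t" if "t \<in> {a..b}" for t
  proof -
    have "clamp a b t = t"
      using that by simp
    then show ?thesis
      using \<Phi>[of \<beta> t] e_pos[of t] by (simp add: fp)
  qed
  show ?thesis
  proof
    show "P \<beta> a = x0"
      by (simp add: P_def)
    show "(P \<beta> has_vector_derivative f t (P \<beta> t)) (at t within {a..b})" if "t \<in> {a..b}" for t
      using P_deriv[OF that, of \<beta>] P_eq[OF that] by simp
  qed
qed

lemma has_vector_derivative_exp_comp:
  fixes C :: "real \<Rightarrow> complex"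
  assumes "(C has_vector_derivative c) (at t within S)"
  shows "((\<lambda>t. exp (C t)) has_vector_derivative c * exp (C t)) (at t within S)"
proof -
  have "(exp \<circ> C has_vector_derivative c * exp (C t)) (at t within S)"
    using assms by (intro field_vector_diff_chain_within) (auto intro: DERIV_exp DERIV_subset)
  then show ?thesis by (simp add: o_def)
qed

text \<open>
  Variation of constants for a scalar complex equation.  It yields both the fact that two solutions
  of the steering equation agree at all times or never, and the a priori bound below.
\<close>

lemma linear_ode_solution:
  fixes D c r :: "real \<Rightarrow> complex"
  assumes c: "continuous_on {a..b} c" and r: "continuous_on {a..b} r"
    and D: "\<And>t. t \<in> {a..b} \<Longrightarrow> (D has_vector_derivative c t * D t + r t) (at t within {a..b})"
    and t: "t \<in> {a..b}"
  shows "D t = exp (integral {a..t} c) *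
    (D a + integral {a..t} (\<lambda>s. exp (- integral {a..s} c) * r s))"
proof -
  define C where "C t = integral {a..t} c" for t
  have C: "(C has_vector_derivative c s) (at s within {a..b})" if "s \<in> {a..b}" for s
    unfolding C_def by (rule integral_has_vector_derivative[OF c that])
  have "((\<lambda>s. exp (- C s) * r s) has_integral exp (- C t) * D t - exp (- C a) * D a) {a..t}"
  proof (rule fundamental_theorem_of_calculus)
    fix s assume "s \<in> {a..t}"
    then have s: "s \<in> {a..b}" using t by auto
    have "((\<lambda>s. exp (- C s) * D s) has_vector_derivative
       exp (- C s) * (c s * D s + r s) + (- c s * exp (- C s)) * D s) (at s within {a..b})"
      by (intro has_vector_derivative_mult has_vector_derivative_exp_comp
          has_vector_derivative_minus C D s)
    then have "((\<lambda>s. exp (- C s) * D s) has_vector_derivative exp (- C s) * r s) (at s within {a..b})"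
      by (simp add: algebra_simps)
    then show "((\<lambda>s. exp (- C s) * D s) has_vector_derivative exp (- C s) * r s) (at s within {a..t})"
      by (rule has_vector_derivative_within_subset) (use t in auto)
  qed (use t in auto)
  then have "integral {a..t} (\<lambda>s. exp (- C s) * r s) = exp (- C t) * D t - D a"
    by (simp add: integral_unique C_def)
  then show ?thesis
    unfolding C_def[symmetric] by (simp add: mult.assoc[symmetric] exp_minus)
qed

lemma linear_ode_bound:
  fixes D c r :: "real \<Rightarrow> complex"
  assumes c: "continuous_on {a..b} c" and r: "continuous_on {a..b} r"
    and D: "\<And>t. t \<in> {a..b} \<Longrightarrow> (D has_vector_derivative c t * D t + r t) (at t within {a..b})"
    and D0: "D a = 0"
    and cM: "\<And>t. t \<in> {a..b} \<Longrightarrow> norm (c t) \<le> M"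
    and rR: "\<And>t. t \<in> {a..b} \<Longrightarrow> norm (r t) \<le> R"
    and t: "t \<in> {a..b}"
  shows "norm (D t) \<le> (exp (M * (b - a)))\<^sup>2 * R * (b - a)"
proof -
  define C where "C t = integral {a..t} c" for t
  have a: "a \<in> {a..b}" using t by simp
  have M: "M \<ge> 0" "R \<ge> 0"
    using cM[OF a] rR[OF a] norm_ge_zero order_trans by blast+
  have C: "norm (C s) \<le> M * (b - a)" if "s \<in> {a..b}" for s
  proof -
    have "norm (C s) \<le> M * (s - a)"
      unfolding C_def
      by (rule integral_bound) (use that c cM in \<open>auto intro: continuous_on_subset\<close>)
    also have "\<dots> \<le> M * (b - a)"
      using M that by (intro mult_left_mono) auto
    finally show ?thesis .
  qed
  have E: "norm (exp (C s)) \<le> exp (M * (b - a))" "norm (exp (- C s)) \<le> exp (M * (b - a))"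
    if "s \<in> {a..b}" for s
    using C[OF that] norm_exp[of "C s"] norm_exp[of "- C s"]
    by (auto intro: order_trans)
  have Ccont: "continuous_on {a..b} C"
    unfolding C_def by (rule indefinite_integral_continuous_1[OF integrable_continuous_interval[OF c]])
  have "norm (integral {a..t} (\<lambda>s. exp (- C s) * r s)) \<le> exp (M * (b - a)) * R * (t - a)"
  proof (rule integral_bound)
    show "continuous_on {a..t} (\<lambda>s. exp (- C s) * r s)"
      using t by (intro continuous_intros continuous_on_subset[OF Ccont] continuous_on_subset[OF r]) auto
    show "norm (exp (- C s) * r s) \<le> exp (M * (b - a)) * R" if "s \<in> {a..t}" for s
      unfolding norm_mult by (intro mult_mono E rR) (use that t in auto)
  qed (use t in auto)
  also have "\<dots> \<le> exp (M * (b - a)) * R * (b - a)"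
    using M t by (intro mult_left_mono) auto
  finally have I: "norm (integral {a..t} (\<lambda>s. exp (- C s) * r s)) \<le> exp (M * (b - a)) * R * (b - a)" .
  have "D t = exp (C t) * integral {a..t} (\<lambda>s. exp (- C s) * r s)"
    using linear_ode_solution[OF c r D t] by (simp add: D0 C_def)
  also have "norm \<dots> \<le> exp (M * (b - a)) * (exp (M * (b - a)) * R * (b - a))"
    unfolding norm_mult by (intro mult_mono I E t) auto
  finally show ?thesis by (simp add: power2_eq_square mult.assoc)
qed

section \<open>The motion of one towed rod\<close>

lemma continuous_on_interval_norm_bound:
  fixes f :: "real \<Rightarrow> 'a::real_normed_vector"
  assumes "continuous_on {a..b} f"
  obtains B where "\<And>t. t \<in> {a..b} \<Longrightarrow> norm (f t) \<le> B"
  using compact_imp_bounded[OF compact_continuous_image[OF assms compact_Icc]]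
  unfolding bounded_iff by blast

text \<open>
  The steering equation of one rod.  A rod of length \<open>l\<close> whose front end \<open>x\<close> moves with velocity \<open>u\<close>
  and whose rear end \<open>x - l z\<close> cannot slip sideways turns at the rate \<open>Im (cnj z * u) / l\<close>: this is the
  component of \<open>u\<close> orthogonal to the rod, divided by its length.
\<close>

definition towed :: "real \<Rightarrow> real \<Rightarrow> real \<Rightarrow> (real \<Rightarrow> complex) \<Rightarrow> (real \<Rightarrow> complex) \<Rightarrow> bool" where
  "towed l a b u z \<longleftrightarrow> (\<forall>t\<in>{a..b}. norm (z t) = 1 \<and>
     (z has_vector_derivative (Im (cnj (z t) * u t) / l) *\<^sub>R (\<i> * z t)) (at t within {a..b}))"

lemma unit_cnj_mult:
  assumes "norm (z::complex) = 1"
  shows "cnj z * z = 1" "z * cnj z = 1"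
  using assms by (simp_all add: complex_norm_square[symmetric] mult.commute[of "cnj z"])

text \<open>
  On the unit circle the steering equation is a Riccati equation that is holomorphic in \<open>z\<close>.  Therefore
  the difference of two solutions satisfies a linear equation, which is what makes uniqueness, the
  a priori bound and the linearization elementary.
\<close>

lemma towing_velocity_riccati:
  assumes "norm (z::complex) = 1"
  shows "(Im (cnj z * u) / l) *\<^sub>R (\<i> * z) = (u - z\<^sup>2 * cnj u) / (2 * of_real l)"
proof -
  define v where "v = cnj z * u"
  have "of_real (2 * Im v) * \<i> = v - cnj v"
    using complex_diff_cnj[of v] by simp
  then have "of_real (2 * Im v) * \<i> * z = (v - cnj v) * z"
    by (simp only:)
  also have "\<dots> = (cnj z * z) * u - z\<^sup>2 * cnj u"
    by (simp add: v_def algebra_simps power2_eq_square)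
  finally have "of_real (2 * Im v) * \<i> * z = u - z\<^sup>2 * cnj u"
    using unit_cnj_mult(1)[OF assms] by simp
  moreover have "(Im v / l) *\<^sub>R (\<i> * z) = (of_real (2 * Im v) * \<i> * z) / (2 * of_real l)"
    by (simp add: scaleR_conv_of_real)
  ultimately show ?thesis
    by (simp only: v_def)
qed

lemma towed_riccati:
  assumes "towed l a b u z" "t \<in> {a..b}"
  shows "(z has_vector_derivative (u t - (z t)\<^sup>2 * cnj (u t)) / (2 * of_real l)) (at t within {a..b})"
proof -
  have "norm (z t) = 1" "(z has_vector_derivative (Im (cnj (z t) * u t) / l) *\<^sub>R (\<i> * z t)) (at t within {a..b})"
    using assms by (auto simp only: towed_def)
  then show ?thesis
    by (simp only: towing_velocity_riccati)
qed

lemma towed_continuous: "towed l a b u z \<Longrightarrow> continuous_on {a..b} z"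
  unfolding towed_def
  by (metis continuous_on_eq_continuous_within has_vector_derivative_continuous)

text \<open>
  The Riccati form is not globally Lipschitz in \<open>z\<close>, but the equation for the angle is, because
  \<open>\<alpha> \<mapsto> cis \<alpha>\<close> does not increase distances.
\<close>

lemma towed_exists:
  assumes ab: "a \<le> b" and u: "continuous_on {a..b} u" and z0: "norm z0 = 1"
  obtains z where "z a = z0" "towed l a b u z"
proof -
  define f where "f t \<alpha> = Im (cnj (cis \<alpha>) * u t) / l" for t \<alpha>
  obtain U where U: "\<And>t. t \<in> {a..b} \<Longrightarrow> norm (u t) \<le> U"
    using continuous_on_interval_norm_bound[OF u] by blast
  have lip: "norm (f t x - f t y) \<le> (U / \<bar>l\<bar>) * norm (x - y)" if "t \<in> {a..b}" for t x y
  proof -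
    have "norm (cis x - cis y) \<le> norm (x - y)"
    proof -
      have "norm (cis x - cis y) \<le> 1 * norm (x - y)"
      proof (rule differentiable_bound[of UNIV cis "\<lambda>x h. h *\<^sub>R (\<i> * cis x)"])
        show "(cis has_derivative (\<lambda>h. h *\<^sub>R (\<i> * cis x))) (at x within UNIV)" for x
          using has_derivative_cis[OF has_derivative_ident, of x UNIV] by simp
        show "onorm (\<lambda>h. h *\<^sub>R (\<i> * cis x)) \<le> 1" for x
          by (rule onorm_le) (simp add: norm_mult)
      qed auto
      then show ?thesis by simp
    qed
    have "f t x - f t y = Im (cnj (cis x - cis y) * u t) / l"
      by (simp only: f_def diff_divide_distrib minus_complex.sel left_diff_distrib complex_cnj_diff)
    also have "norm \<dots> \<le> norm (cnj (cis x - cis y) * u t) / \<bar>l\<bar>"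
      unfolding real_norm_def abs_divide by (intro divide_right_mono abs_Im_le_cmod) simp
    also have "\<dots> \<le> norm (x - y) * U / \<bar>l\<bar>"
      unfolding norm_mult complex_mod_cnj
      by (intro divide_right_mono mult_mono U that \<open>norm (cis x - cis y) \<le> norm (x - y)\<close>) auto
    finally show ?thesis by (simp add: mult_ac)
  qed
  have cont: "continuous_on {a..b} (\<lambda>t. f t (y t))" if "continuous_on {a..b} y" for y
    unfolding f_def divide_inverse by (intro continuous_intros that u)
  obtain \<alpha> where \<alpha>: "\<alpha> a = Arg z0"
    "\<And>t. t \<in> {a..b} \<Longrightarrow> (\<alpha> has_vector_derivative f t (\<alpha> t)) (at t within {a..b})"
    using picard_lindelof[OF ab cont lip] by metis
  show ?thesis
  proof
    show "cis (\<alpha> a) = z0"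
      using z0 \<alpha>(1) cis_Arg[of z0] by (cases "z0 = 0") (auto simp: sgn_eq)
    show "towed l a b u (\<lambda>t. cis (\<alpha> t))"
      unfolding towed_def
    proof safe
      fix t assume "t \<in> {a..b}"
      from \<alpha>(2)[OF this]
      show "((\<lambda>t. cis (\<alpha> t)) has_vector_derivative
          (Im (cnj (cis (\<alpha> t)) * u t) / l) *\<^sub>R (\<i> * cis (\<alpha> t))) (at t within {a..b})"
        unfolding has_vector_derivative_def f_def[symmetric]
        by (auto dest!: has_derivative_cis simp: mult_ac)
    qed simp
  qed
qed

lemma towed_difference:
  assumes z: "towed l a b u z" and w: "towed l a b (\<lambda>t. u t + h t) w" and t: "t \<in> {a..b}"
  shows "((\<lambda>t. w t - z t) has_vector_derivative
      - ((w t + z t) * cnj (u t) / (2 * of_real l)) * (w t - z t)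
      + (h t - (w t)\<^sup>2 * cnj (h t)) / (2 * of_real l)) (at t within {a..b})"
proof -
  have "((\<lambda>t. w t - z t) has_vector_derivative
      ((u t + h t) - (w t)\<^sup>2 * cnj (u t + h t)) / (2 * of_real l)
       - (u t - (z t)\<^sup>2 * cnj (u t)) / (2 * of_real l)) (at t within {a..b})"
    by (intro has_vector_derivative_diff towed_riccati[OF z t] towed_riccati[OF w t])
  moreover have "((u t + h t) - (w t)\<^sup>2 * cnj (u t + h t)) - (u t - (z t)\<^sup>2 * cnj (u t))
      = - ((w t + z t) * cnj (u t)) * (w t - z t) + (h t - (w t)\<^sup>2 * cnj (h t))"
    by (simp add: algebra_simps power2_eq_square)
  ultimately show ?thesis
    by (simp only: diff_divide_distrib[symmetric] add_divide_distrib times_divide_eq_left minus_divide_left)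
qed

text \<open>
  Uniqueness is one half of this; the other half, that rods of equal length which start in different
  directions never become parallel, shows that no trajectory leaves the configuration space.
\<close>

lemma towed_eq_iff_start:
  assumes u: "continuous_on {a..b} u"
    and z: "towed l a b u z" and w: "towed l a b u w" and t: "t \<in> {a..b}"
  shows "w t = z t \<longleftrightarrow> w a = z a"
proof -
  have c: "continuous_on {a..b} (\<lambda>t. - ((w t + z t) * cnj (u t) / (2 * of_real l)))"
    unfolding divide_inverse by (intro continuous_intros u towed_continuous[OF z] towed_continuous[OF w])
  have "w t - z t = exp (integral {a..t} (\<lambda>t. - ((w t + z t) * cnj (u t) / (2 * of_real l)))) * (w a - z a)"
    using linear_ode_solution[OF c, of "\<lambda>_. 0" "\<lambda>t. w t - z t" t]
      towed_difference[of l a b u z "\<lambda>_. 0" w] z w t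
    by simp
  then have "w t - z t = 0 \<longleftrightarrow> w a - z a = 0"
    by simp
  then show ?thesis
    by simp
qed

text \<open>
  The weight \<open>g\<close> is the integrating factor of the linearized steering equation: an infinitesimal
  rotation of the rod evolves along the motion in proportion to \<open>1 / g\<close>.
\<close>

definition towing_weight ::
  "real \<Rightarrow> real \<Rightarrow> real \<Rightarrow> (real \<Rightarrow> complex) \<Rightarrow> (real \<Rightarrow> complex) \<Rightarrow> (real \<Rightarrow> real) \<Rightarrow> bool" where
  "towing_weight l a b u z g \<longleftrightarrow> g a = 1 \<and> (\<forall>t\<in>{a..b}. g t > 0 \<and>
     (g has_real_derivative g t * Re (cnj (z t) * u t) / l) (at t within {a..b}))"

lemma towing_weight_exists:
  assumes u: "continuous_on {a..b} u" and z: "towed l a b u z"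
  obtains g where "towing_weight l a b u z g"
proof
  define k where "k t = Re (cnj (z t) * u t) / l" for t
  have k: "continuous_on {a..b} k"
    unfolding k_def divide_inverse by (intro continuous_intros u towed_continuous[OF z])
  show "towing_weight l a b u z (\<lambda>t. exp (integral {a..t} k))"
    unfolding towing_weight_def
  proof (intro conjI ballI)
    fix t assume "t \<in> {a..b}"
    from integral_has_real_derivative[OF k this]
    have "((\<lambda>t. exp (integral {a..t} k)) has_real_derivative exp (integral {a..t} k) * k t) (at t within {a..b})"
      by (rule DERIV_chain2[OF DERIV_exp])
    then show "((\<lambda>t. exp (integral {a..t} k)) has_real_derivative
        exp (integral {a..t} k) * Re (cnj (z t) * u t) / l) (at t within {a..b})"
      by (simp only: k_def times_divide_eq_right)
  qed auto
qed

lemma towing_weight_continuous: "towing_weight l a b u z g \<Longrightarrow> continuous_on {a..b} g"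
  by (rule DERIV_continuous_on[where D = "\<lambda>t. g t * Re (cnj (z t) * u t) / l"]) (simp only: towing_weight_def)

text \<open>
  The weighted direction \<open>g z\<close> is driven by \<open>g u / l\<close> alone: the rotation rate \<open>\<i> Im (cnj z * u) / l\<close>
  of \<open>z\<close> and the growth rate \<open>Re (cnj z * u) / l\<close> of \<open>g\<close> add up to \<open>cnj z * u / l\<close>, and \<open>z * cnj z = 1\<close>.
\<close>

lemma towing_weight_direction:
  assumes z: "towed l a b u z" and g: "towing_weight l a b u z g" and t: "t \<in> {a..b}"
  shows "((\<lambda>t. of_real (g t) * z t) has_vector_derivative of_real (g t / l) * u t) (at t within {a..b})"
proof -
  have n: "norm (z t) = 1"
    and dg: "(g has_real_derivative g t * Re (cnj (z t) * u t) / l) (at t within {a..b})"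
    using z g t by (auto simp only: towed_def towing_weight_def)
  define v where "v = cnj (z t) * u t"
  have dG: "((\<lambda>t. complex_of_real (g t)) has_vector_derivative of_real (g t * Re v / l)) (at t within {a..b})"
    using has_vector_derivative_of_real[OF dg]
    by (simp only: v_def)
  have "(v + cnj v) * z t = (cnj (z t) * z t) * u t + (z t)\<^sup>2 * cnj (u t)"
    by (simp add: v_def algebra_simps power2_eq_square)
  then have "of_real (2 * Re v) * z t = u t + (z t)\<^sup>2 * cnj (u t)"
    unfolding unit_cnj_mult(1)[OF n] complex_add_cnj by simp
  then have "(u t - (z t)\<^sup>2 * cnj (u t)) / (2 * of_real l) = (2 * u t - of_real (2 * Re v) * z t) / (2 * of_real l)"
    by simp
  also have "\<dots> = (u t - of_real (Re v) * z t) / of_real l"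
    by (simp add: diff_divide_distrib)
  finally have "((\<lambda>t. of_real (g t) * z t) has_vector_derivative
      of_real (g t) * ((u t - of_real (Re v) * z t) / of_real l) + of_real (g t * Re v / l) * z t) (at t within {a..b})"
    using has_vector_derivative_mult[OF dG towed_riccati[OF z t]] by (simp only:)
  moreover have "of_real (g t) * ((u t - of_real (Re v) * z t) / of_real l) + of_real (g t * Re v / l) * z t
      = of_real (g t / l) * u t"
    by (simp add: diff_divide_distrib right_diff_distrib)
  ultimately show ?thesis by (simp only:)
qed

text \<open>
  At every time the direction depends Lipschitz continuously on the towing velocity; hence terms that are
  quadratic in the difference of the directions are quadratic in the perturbation \<open>h\<close>.
\<close>

lemma towed_difference_bound:
  assumes l: "l > 0" and u: "continuous_on {a..b} u" and h: "continuous_on {a..b} h"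
    and z: "towed l a b u z" and w: "towed l a b (\<lambda>t. u t + h t) w" and start: "w a = z a"
    and U: "\<And>t. t \<in> {a..b} \<Longrightarrow> norm (u t) \<le> U" and H: "\<And>t. t \<in> {a..b} \<Longrightarrow> norm (h t) \<le> H"
    and t: "t \<in> {a..b}"
  shows "norm (w t - z t) \<le> (exp (U / l * (b - a)))\<^sup>2 * (H / l) * (b - a)"
proof (rule linear_ode_bound[where D = "\<lambda>t. w t - z t"])
  have nz: "norm (z s) = 1" and nw: "norm (w s) = 1" if "s \<in> {a..b}" for s
    using z w that by (auto simp only: towed_def)
  show "((\<lambda>t. w t - z t) has_vector_derivative - ((w s + z s) * cnj (u s) / (2 * of_real l)) * (w s - z s)
      + (h s - (w s)\<^sup>2 * cnj (h s)) / (2 * of_real l)) (at s within {a..b})" if "s \<in> {a..b}" for s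
    by (rule towed_difference[OF z w that])
  show "norm (- ((w s + z s) * cnj (u s) / (2 * of_real l))) \<le> U / l" if "s \<in> {a..b}" for s
  proof -
    have "norm (w s + z s) * norm (u s) \<le> 2 * U"
      using nw[OF that] nz[OF that] norm_triangle_ineq[of "w s" "z s"] U[OF that]
      by (intro mult_mono) auto
    from divide_right_mono[OF this, of "2 * l"] show ?thesis
      using l by (simp add: norm_mult norm_divide)
  qed
  show "norm ((h s - (w s)\<^sup>2 * cnj (h s)) / (2 * of_real l)) \<le> H / l" if "s \<in> {a..b}" for s
  proof -
    have "norm (h s - (w s)\<^sup>2 * cnj (h s)) \<le> 2 * H"
      using norm_triangle_ineq4[of "h s" "(w s)\<^sup>2 * cnj (h s)"] H[OF that] nw[OF that]
      by (simp add: norm_mult norm_power)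
    then show ?thesis using l by (simp add: norm_divide field_simps)
  qed
  have zc: "continuous_on {a..b} z" and wc: "continuous_on {a..b} w"
    by (rule towed_continuous[OF z] towed_continuous[OF w])+
  show "continuous_on {a..b} (\<lambda>s. - ((w s + z s) * cnj (u s) / (2 * of_real l)))"
    "continuous_on {a..b} (\<lambda>s. (h s - (w s)\<^sup>2 * cnj (h s)) / (2 * of_real l))"
    unfolding divide_inverse by (intro continuous_intros h u zc wc)+
qed (use t start in auto)

text \<open>
  Multiplied by \<open>g * cnj z\<close>, the difference of two motions of the rod is the integral of the forcing
  term \<open>\<i> g Im (cnj z * h) / l\<close>, up to a remainder \<open>R\<close> that is quadratic in \<open>h\<close> and \<open>w - z\<close>: the linear part of
  the Riccati equation is cancelled by the derivative of \<open>g * cnj z\<close>.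
\<close>

lemma weighted_difference_derivative:
  assumes l: "l \<noteq> 0" and z: "towed l a b u z" and g: "towing_weight l a b u z g"
    and w: "towed l a b (\<lambda>t. u t + h t) w" and t: "t \<in> {a..b}"
  defines "R \<equiv> \<lambda>t. - ((w t + z t) * (w t - z t) * cnj (h t) + cnj (u t) * (w t - z t)\<^sup>2) / (2 * of_real l)"
  shows "((\<lambda>t. of_real (g t) * cnj (z t) * (w t - z t)) has_vector_derivative
      \<i> * of_real (g t * Im (cnj (z t) * h t) / l) + of_real (g t) * cnj (z t) * R t) (at t within {a..b})"
proof -
  have nz: "norm (z t) = 1"
    using z t by (auto simp only: towed_def)
  define D where "D = w t - z t"
  define L where "L = complex_of_real l"
  have L: "L \<noteq> 0" using l by (simp add: L_def)
  define Q where "Q = of_real (g t) * cnj (z t)"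
  have "((\<lambda>t. cnj (of_real (g t) * z t)) has_vector_derivative cnj (of_real (g t / l) * u t)) (at t within {a..b})"
    by (rule bounded_linear.has_vector_derivative[OF bounded_linear_cnj towing_weight_direction[OF z g t]])
  then have dQ: "((\<lambda>t. of_real (g t) * cnj (z t)) has_vector_derivative of_real (g t / l) * cnj (u t)) (at t within {a..b})"
    by (simp only: complex_cnj_mult complex_cnj_complex_of_real)
  have eq: "\<i> * of_real (g t * Im (cnj (z t) * h t) / l) = Q * ((h t - (z t)\<^sup>2 * cnj (h t)) / (2 * L))"
  proof -
    define v where "v = Im (cnj (z t) * h t)"
    have "Q * ((v / l) *\<^sub>R (\<i> * z t)) = \<i> * of_real (g t * v / l) * (cnj (z t) * z t)"
      by (simp add: scaleR_conv_of_real Q_def)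
    then show ?thesis
      unfolding v_def towing_velocity_riccati[OF nz] L_def using unit_cnj_mult(1)[OF nz] by simp
  qed
  \<comment> \<open>With \<open>w = z + D\<close>, this isolates the linearized equation for \<open>D\<close>.\<close>
  have split: "- ((w t + z t) * cnj (u t) / (2 * L)) * D + (h t - (w t)\<^sup>2 * cnj (h t)) / (2 * L)
      = (h t - (z t)\<^sup>2 * cnj (h t)) / (2 * L) - z t * cnj (u t) * D / L + R t"
  proof -
    have w_eq: "w t = z t + D" by (simp add: D_def)
    define uc hc where "uc = cnj (u t)" and "hc = cnj (h t)"
    have num: "- ((w t + z t) * uc) * D + (h t - (w t)\<^sup>2 * hc)
        = h t - (z t)\<^sup>2 * hc - 2 * (z t * uc * D) + - ((w t + z t) * D * hc + uc * D\<^sup>2)"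
      unfolding w_eq by (simp add: algebra_simps power2_eq_square)
    have R: "R t = - ((w t + z t) * D * hc + uc * D\<^sup>2) / (2 * L)"
      by (simp only: R_def L_def D_def uc_def hc_def)
    have cancel: "z t * uc * D / L = 2 * (z t * uc * D) / (2 * L)"
      by simp
    show ?thesis
      unfolding R uc_def[symmetric] hc_def[symmetric] cancel
        diff_divide_distrib[symmetric] add_divide_distrib[symmetric] num[symmetric]
      by (simp only: add_divide_distrib minus_divide_left[symmetric] times_divide_eq_left mult_minus_left)
  qed
  have gz: "Q * (z t * cnj (u t) * D / L) = of_real (g t / l) * cnj (u t) * D"
  proof -
    have "Q * (z t * cnj (u t) * D / L) = (cnj (z t) * z t) * (of_real (g t) * cnj (u t) * D / L)"
      by (simp add: Q_def)
    then show ?thesis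
      using unit_cnj_mult(1)[OF nz] by (simp add: L_def)
  qed
  have "((\<lambda>t. of_real (g t) * cnj (z t) * (w t - z t)) has_vector_derivative
      Q * (- ((w t + z t) * cnj (u t) / (2 * L)) * D + (h t - (w t)\<^sup>2 * cnj (h t)) / (2 * L))
      + of_real (g t / l) * cnj (u t) * D) (at t within {a..b})"
    unfolding Q_def L_def D_def
    by (rule has_vector_derivative_mult[OF dQ towed_difference[OF z w t]])
  then show ?thesis
    unfolding split distrib_left right_diff_distrib gz eq Q_def[symmetric] by simp
qed

text \<open>
  First-order expansion of the final direction with respect to the towing velocity.  The constant \<open>K\<close>
  does not depend on the perturbation \<open>h\<close>, so the expansion is a Frechet derivative for the supremum
  norm.
\<close>

lemma towed_expansion:
  assumes ab: "a \<le> b" and l: "l > 0" and u: "continuous_on {a..b} u"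
    and z: "towed l a b u z" and g: "towing_weight l a b u z g"
  shows "\<exists>K\<ge>0. \<forall>h w H. continuous_on {a..b} h \<longrightarrow> towed l a b (\<lambda>t. u t + h t) w \<longrightarrow> w a = z a \<longrightarrow>
      (\<forall>t\<in>{a..b}. norm (h t) \<le> H) \<longrightarrow>
      norm (w b - z b - (integral {a..b} (\<lambda>t. g t * Im (cnj (z t) * h t) / l) / g b) *\<^sub>R (\<i> * z b)) \<le> K * H\<^sup>2"
proof -
  obtain U where U: "\<And>t. t \<in> {a..b} \<Longrightarrow> norm (u t) \<le> U"
    using continuous_on_interval_norm_bound[OF u] by blast
  have gc: "continuous_on {a..b} g" by (rule towing_weight_continuous[OF g])
  obtain G where G: "\<And>t. t \<in> {a..b} \<Longrightarrow> norm (g t) \<le> G"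
    using continuous_on_interval_norm_bound[OF gc] by blast
  have ends: "a \<in> {a..b}" "b \<in> {a..b}" using ab by auto
  have U0: "U \<ge> 0" and G0: "G \<ge> 0"
    using order_trans[OF norm_ge_zero U[OF ends(1)]] order_trans[OF norm_ge_zero G[OF ends(1)]] .
  have gb: "g b > 0" using g ends(2) by (simp only: towing_weight_def)
  have zc: "continuous_on {a..b} z" by (rule towed_continuous[OF z])
  have nz: "norm (z t) = 1" if "t \<in> {a..b}" for t
    using z that by (auto simp only: towed_def)
  \<comment> \<open>\<open>k\<close> bounds \<open>\<bar>w - z\<bar>\<close> relative to \<open>H\<close>, and \<open>B\<close> bounds the remainder relative to \<open>H\<^sup>2\<close>.\<close>
  define k where "k = (exp (U / l * (b - a)))\<^sup>2 * (b - a) / l"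
  define B where "B = (2 * k + U * k\<^sup>2) / (2 * l)"
  define K where "K = G * B * (b - a) / g b"
  have k0: "k \<ge> 0" and B0: "B \<ge> 0"
    using ab l U0 by (auto simp: k_def B_def)
  show ?thesis
  proof (intro exI[of _ K] conjI allI impI)
    show "K \<ge> 0" using ab gb G0 B0 by (simp add: K_def)
    fix h w H
    assume h: "continuous_on {a..b} h" and w: "towed l a b (\<lambda>t. u t + h t) w"
      and start: "w a = z a" and "\<forall>t\<in>{a..b}. norm (h t) \<le> H"
    then have H: "norm (h t) \<le> H" if "t \<in> {a..b}" for t
      using that by blast
    have wc: "continuous_on {a..b} w" by (rule towed_continuous[OF w])
    have nw: "norm (w t) = 1" if "t \<in> {a..b}" for t
      using w that by (auto simp only: towed_def)
    have H0: "H \<ge> 0" by (rule order_trans[OF norm_ge_zero H[OF ends(1)]])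
    have D_le: "norm (w t - z t) \<le> k * H" if t: "t \<in> {a..b}" for t
      using towed_difference_bound[OF l u h z w start U H t] by (simp add: k_def mult_ac)
    define R where "R t = - ((w t + z t) * (w t - z t) * cnj (h t) + cnj (u t) * (w t - z t)\<^sup>2) / (2 * of_real l)" for t
    have Rc: "continuous_on {a..b} R"
      unfolding R_def using l by (intro continuous_intros h wc zc u) auto
    have R_le: "norm (R t) \<le> B * H\<^sup>2" if t: "t \<in> {a..b}" for t
    proof -
      have "norm (w t + z t) * norm (w t - z t) * norm (h t) \<le> 2 * (k * H) * H"
        using nw[OF t] nz[OF t] norm_triangle_ineq[of "w t" "z t"] k0 H0
        by (intro mult_mono D_le H t) auto
      moreover have "norm (u t) * (norm (w t - z t))\<^sup>2 \<le> U * (k * H)\<^sup>2"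
        using U0 by (intro mult_mono power_mono D_le U t) auto
      moreover have "norm ((w t + z t) * (w t - z t) * cnj (h t) + cnj (u t) * (w t - z t)\<^sup>2)
          \<le> norm (w t + z t) * norm (w t - z t) * norm (h t) + norm (u t) * (norm (w t - z t))\<^sup>2"
        by (rule order_trans[OF norm_triangle_ineq]) (simp add: norm_mult norm_power)
      ultimately have "norm ((w t + z t) * (w t - z t) * cnj (h t) + cnj (u t) * (w t - z t)\<^sup>2)
          \<le> 2 * (k * H) * H + U * (k * H)\<^sup>2"
        by linarith
      also have "\<dots> = (2 * k + U * k\<^sup>2) * H\<^sup>2"
        by (simp add: power_mult_distrib power2_eq_square distrib_right)
      finally have "norm ((w t + z t) * (w t - z t) * cnj (h t) + cnj (u t) * (w t - z t)\<^sup>2)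
          \<le> (2 * k + U * k\<^sup>2) * H\<^sup>2" .
      from divide_right_mono[OF this, of "2 * l"] show ?thesis
        using l by (simp add: R_def B_def norm_divide del: minus_add_distrib minus_diff_eq)
    qed
    define Q where "Q t = of_real (g t) * cnj (z t)" for t
    define I where "I = integral {a..b} (\<lambda>t. g t * Im (cnj (z t) * h t) / l)"
    have total: "((\<lambda>t. \<i> * of_real (g t * Im (cnj (z t) * h t) / l) + Q t * R t) has_integral
        Q b * (w b - z b) - Q a * (w a - z a)) {a..b}"
      unfolding Q_def R_def
      by (rule fundamental_theorem_of_calculus[OF ab weighted_difference_derivative[OF _ z g w]])
        (use l in simp)
    have "((\<lambda>t. g t * Im (cnj (z t) * h t) / l) has_integral I) {a..b}"
      unfolding I_def divide_inverse
      by (intro integrable_integral integrable_continuous_interval continuous_intros gc zc h)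
    then have main: "((\<lambda>t. \<i> * complex_of_real (g t * Im (cnj (z t) * h t) / l)) has_integral \<i> * of_real I) {a..b}"
      by (intro has_integral_mult_right has_integral_of_real)
    have "((\<lambda>t. Q t * R t) has_integral Q b * (w b - z b) - Q a * (w a - z a) - \<i> * of_real I) {a..b}"
      using has_integral_diff[OF total main] by (simp only: add_diff_cancel_left')
    then have QR: "integral {a..b} (\<lambda>t. Q t * R t) = Q b * (w b - z b) - \<i> * of_real I"
      using start by (simp add: integral_unique)
    have bound: "norm (integral {a..b} (\<lambda>t. Q t * R t)) \<le> G * (B * H\<^sup>2) * (b - a)"
    proof (rule integral_bound[OF ab])
      show "continuous_on {a..b} (\<lambda>t. Q t * R t)"
        unfolding Q_def by (intro continuous_intros gc zc Rc)
      show "norm (Q t * R t) \<le> G * (B * H\<^sup>2)" if "t \<in> {a..b}" for t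
        unfolding norm_mult using G[OF that] R_le[OF that] G0 nz[OF that]
        by (intro mult_mono) (auto simp: Q_def norm_mult)
    qed
    have "z b / of_real (g b) * (Q b * (w b - z b)) = (z b * cnj (z b)) * (w b - z b)"
      using gb by (simp add: Q_def)
    then have "w b - z b - (I / g b) *\<^sub>R (\<i> * z b) = z b / of_real (g b) * (Q b * (w b - z b) - \<i> * of_real I)"
      using unit_cnj_mult(2)[OF nz[OF ends(2)]]
      by (simp only: right_diff_distrib[of "z b / of_real (g b)"] mult_1_left)
         (simp add: scaleR_conv_of_real)
    then have "norm (w b - z b - (I / g b) *\<^sub>R (\<i> * z b)) = norm (integral {a..b} (\<lambda>t. Q t * R t)) / g b"
      using nz[OF ends(2)] gb by (simp only: QR norm_mult norm_divide) simp
    also have "\<dots> \<le> K * H\<^sup>2"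
      using divide_right_mono[OF bound, of "g b"] gb by (simp add: K_def mult_ac)
    finally show "norm (w b - z b - (integral {a..b} (\<lambda>t. g t * Im (cnj (z t) * h t) / l) / g b)
        *\<^sub>R (\<i> * z b)) \<le> K * H\<^sup>2"
      by (simp only: I_def)
  qed
qed

section \<open>Trajectories of the linkage and the endpoint map\<close>

definition velocity :: "control \<Rightarrow> real \<Rightarrow> complex" where
  "velocity u t = Complex (fst (apply_bcontfun u t)) (snd (apply_bcontfun u t))"

lemma velocity_add: "velocity (u + h) t = velocity u t + velocity h t"
  by (simp add: velocity_def complex_eq_iff)

lemma velocity_continuous [continuous_intros]: "continuous_on S (velocity u)"
  unfolding velocity_def Complex_eq
  by (auto intro!: continuous_intros)

lemma norm_velocity_le: "norm (velocity u t) \<le> norm u"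
proof -
  have "norm (velocity u t) = norm (apply_bcontfun u t)"
    by (simp add: velocity_def norm_prod_def complex_norm)
  then show ?thesis using norm_bounded[of u t] by simp
qed

lemma frame_combination:
  "c1 *\<^sub>R v1 l1 l2 q + c2 *\<^sub>R v2 l1 l2 q =
    (Complex c1 c2, (Im (cnj (dir1 q) * Complex c1 c2) / l1) *\<^sub>R (\<i> * dir1 q),
      (Im (cnj (dir2 q) * Complex c1 c2) / l2) *\<^sub>R (\<i> * dir2 q))"
  by (simp add: v1_def v2_def d_x1_def d_x2_def d_\<alpha>1_def d_\<alpha>2_def complex_eq_iff
      diff_divide_distrib algebra_simps)

lemma has_vector_derivative_Pair_iff:
  "(f has_vector_derivative (x, y)) (at t within S) \<longleftrightarrow>
    ((\<lambda>t. fst (f t)) has_vector_derivative x) (at t within S) \<and>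
    ((\<lambda>t. snd (f t)) has_vector_derivative y) (at t within S)"
proof
  assume f: "(f has_vector_derivative (x, y)) (at t within S)"
  show "((\<lambda>t. fst (f t)) has_vector_derivative x) (at t within S) \<and>
    ((\<lambda>t. snd (f t)) has_vector_derivative y) (at t within S)"
    using bounded_linear.has_vector_derivative[OF bounded_linear_fst f]
      bounded_linear.has_vector_derivative[OF bounded_linear_snd f] by simp
next
  assume "((\<lambda>t. fst (f t)) has_vector_derivative x) (at t within S) \<and>
    ((\<lambda>t. snd (f t)) has_vector_derivative y) (at t within S)"
  then show "(f has_vector_derivative (x, y)) (at t within S)"
    using has_vector_derivative_Pair[of "\<lambda>t. fst (f t)" x t S "\<lambda>t. snd (f t)" y] by simp
qed

lemma config_space_iff:
  assumes "l1 > 0" "l2 > 0"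
  shows "q \<in> config_space l1 l2 \<longleftrightarrow>
    norm (dir1 q) = 1 \<and> norm (dir2 q) = 1 \<and> \<not> (l1 = l2 \<and> dir1 q = dir2 q)"
proof -
  have "l1 *\<^sub>R dir1 q = l2 *\<^sub>R dir2 q \<longleftrightarrow> l1 = l2 \<and> dir1 q = dir2 q"
    if n: "norm (dir1 q) = 1" "norm (dir2 q) = 1"
  proof
    assume eq: "l1 *\<^sub>R dir1 q = l2 *\<^sub>R dir2 q"
    have "l1 = norm (l1 *\<^sub>R dir1 q)" "l2 = norm (l2 *\<^sub>R dir2 q)"
      using assms n by simp_all
    then have "l1 = l2" using eq by simp
    then show "l1 = l2 \<and> dir1 q = dir2 q" using eq assms by simp
  qed simp
  then show ?thesis
    by (cases q) (auto simp: config_space_def m1_def m2_def)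
qed

text \<open>
  A trajectory decouples into the motion of \<open>x\<close> and two rods that are towed by \<open>x\<close> independently of
  each other.
\<close>

lemma trajectory_iff:
  assumes l: "l1 > 0" "l2 > 0"
  shows "trajectory l1 l2 a b u \<gamma> \<longleftrightarrow>
    (\<forall>t\<in>{a..b}. \<gamma> t \<in> config_space l1 l2) \<and>
    (\<forall>t\<in>{a..b}. ((\<lambda>t. pos (\<gamma> t)) has_vector_derivative velocity u t) (at t within {a..b})) \<and>
    towed l1 a b (velocity u) (\<lambda>t. dir1 (\<gamma> t)) \<and> towed l2 a b (velocity u) (\<lambda>t. dir2 (\<gamma> t))"
  unfolding trajectory_def towed_def frame_combination has_vector_derivative_Pair_iff
    velocity_def[symmetric] config_space_iff[OF l] by blast

text \<open>
  Solutions for the two rods exist separately; the excluded locus \<open>m\<^sub>1 = m\<^sub>2\<close> is invariant under the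
  motion, so it is not reached from outside.
\<close>

lemma trajectory_exists:
  assumes l: "l1 > 0" "l2 > 0" and ab: "a \<le> b" and q0: "q0 \<in> config_space l1 l2"
  obtains \<gamma> where "trajectory l1 l2 a b u \<gamma>" "\<gamma> a = q0"
proof -
  have n: "norm (dir1 q0) = 1" "norm (dir2 q0) = 1" and ne: "\<not> (l1 = l2 \<and> dir1 q0 = dir2 q0)"
    using q0 unfolding config_space_iff[OF l] by blast+
  obtain z1 where z1: "z1 a = dir1 q0" "towed l1 a b (velocity u) z1"
    by (rule towed_exists[OF ab velocity_continuous n(1)])
  obtain z2 where z2: "z2 a = dir2 q0" "towed l2 a b (velocity u) z2"
    by (rule towed_exists[OF ab velocity_continuous n(2)])
  define x where "x t = pos q0 + integral {a..t} (velocity u)" for t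
  have x: "(x has_vector_derivative velocity u t) (at t within {a..b})" if "t \<in> {a..b}" for t
    unfolding x_def using integral_has_vector_derivative[OF velocity_continuous that, of u]
    by (auto intro!: derivative_eq_intros)
  have "(x t, z1 t, z2 t) \<in> config_space l1 l2" if t: "t \<in> {a..b}" for t
  proof -
    have "norm (z1 t) = 1" "norm (z2 t) = 1"
      using z1(2) z2(2) t by (auto simp only: towed_def)
    moreover have "\<not> (l1 = l2 \<and> z1 t = z2 t)"
      using towed_eq_iff_start[OF velocity_continuous z2(2) _ t, of z1] ne z1 z2(1) by auto
    ultimately show ?thesis
      by (simp add: config_space_iff[OF l])
  qed
  moreover have "x a = pos q0"
    by (simp add: x_def)
  ultimately show ?thesis
    using x z1 z2 by (intro that[of "\<lambda>t. (x t, z1 t, z2 t)"]) (simp_all add: trajectory_iff[OF l])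
qed

lemma trajectory_pos:
  assumes l: "l1 > 0" "l2 > 0" and ab: "a \<le> b" and \<gamma>: "trajectory l1 l2 a b u \<gamma>"
  shows "pos (\<gamma> b) = pos (\<gamma> a) + integral {a..b} (velocity u)"
proof -
  have "(velocity u has_integral pos (\<gamma> b) - pos (\<gamma> a)) {a..b}"
    using \<gamma> by (intro fundamental_theorem_of_calculus[OF ab]) (simp add: trajectory_iff[OF l])
  then show ?thesis
    by (simp add: integral_unique)
qed

text \<open>
  By uniqueness of trajectories the definite description in the endpoint map denotes the end of any
  trajectory at hand; by their existence it is meaningful for every control, so that the map can be
  differentiated on the whole space of controls.
\<close>

lemma endpoint_map_trajectory:
  assumes l: "l1 > 0" "l2 > 0" and ab: "a \<le> b" and \<gamma>: "trajectory l1 l2 a b u \<gamma>"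
  shows "endpoint_map l1 l2 a b (\<gamma> a) u = \<gamma> b"
  unfolding endpoint_map_def
proof (rule the_equality)
  show "\<exists>\<gamma>'. trajectory l1 l2 a b u \<gamma>' \<and> \<gamma>' a = \<gamma> a \<and> \<gamma>' b = \<gamma> b"
    using \<gamma> by blast
  fix q assume "\<exists>\<gamma>'. trajectory l1 l2 a b u \<gamma>' \<and> \<gamma>' a = \<gamma> a \<and> \<gamma>' b = q"
  then obtain \<gamma>' where \<gamma>': "trajectory l1 l2 a b u \<gamma>'" "\<gamma>' a = \<gamma> a" and q: "q = \<gamma>' b"
    by blast
  have b: "b \<in> {a..b}" using ab by simp
  have tow: "towed l1 a b (velocity u) (\<lambda>t. dir1 (\<gamma> t))" "towed l2 a b (velocity u) (\<lambda>t. dir2 (\<gamma> t))"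
    "towed l1 a b (velocity u) (\<lambda>t. dir1 (\<gamma>' t))" "towed l2 a b (velocity u) (\<lambda>t. dir2 (\<gamma>' t))"
    using \<gamma> \<gamma>'(1) by (simp_all add: trajectory_iff[OF l])
  have "dir1 (\<gamma>' b) = dir1 (\<gamma> b)"
    using towed_eq_iff_start[OF velocity_continuous tow(1) tow(3) b] \<gamma>'(2) by simp
  moreover have "dir2 (\<gamma>' b) = dir2 (\<gamma> b)"
    using towed_eq_iff_start[OF velocity_continuous tow(2) tow(4) b] \<gamma>'(2) by simp
  moreover have "pos (\<gamma>' b) = pos (\<gamma> b)"
    using trajectory_pos[OF l ab \<gamma>] trajectory_pos[OF l ab \<gamma>'(1)] \<gamma>'(2) by simp
  ultimately show "q = \<gamma> b"
    unfolding q by (simp add: prod_eq_iff)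
qed

section \<open>Integral operators with full range\<close>

text \<open>
  The general form of the linear maps that occur as differentials of endpoint maps: integration of
  the control against two continuous kernels.
\<close>

definition response ::
  "real \<Rightarrow> real \<Rightarrow> (real \<Rightarrow> 'a::euclidean_space) \<Rightarrow> (real \<Rightarrow> 'a) \<Rightarrow> control \<Rightarrow> 'a" where
  "response a b k1 k2 h =
    integral {a..b} (\<lambda>t. fst (apply_bcontfun h t) *\<^sub>R k1 t + snd (apply_bcontfun h t) *\<^sub>R k2 t)"

context
  fixes a b :: real and k1 k2 :: "real \<Rightarrow> 'a::euclidean_space"
  assumes k1: "continuous_on {a..b} k1" and k2: "continuous_on {a..b} k2"
begin

lemma response_integrable:
  "(\<lambda>t. fst (apply_bcontfun h t) *\<^sub>R k1 t + snd (apply_bcontfun h t) *\<^sub>R k2 t) integrable_on {a..b}"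
  by (intro integrable_continuous_interval continuous_intros k1 k2) auto

lemma response_linear_image:
  assumes "bounded_linear f"
  shows "f (response a b k1 k2 h) =
    integral {a..b} (\<lambda>t. fst (apply_bcontfun h t) *\<^sub>R f (k1 t) + snd (apply_bcontfun h t) *\<^sub>R f (k2 t))"
proof -
  interpret bounded_linear f by fact
  show ?thesis
    unfolding response_def using integral_linear[OF response_integrable[of h] assms]
    by (simp add: o_def add scaleR)
qed

lemma bounded_linear_response:
  assumes ab: "a \<le> b"
  shows "bounded_linear (response a b k1 k2)"
proof -
  obtain B1 where B1: "\<And>t. t \<in> {a..b} \<Longrightarrow> norm (k1 t) \<le> B1"
    using continuous_on_interval_norm_bound[OF k1] by blast
  obtain B2 where B2: "\<And>t. t \<in> {a..b} \<Longrightarrow> norm (k2 t) \<le> B2"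
    using continuous_on_interval_norm_bound[OF k2] by blast
  show ?thesis
  proof (rule bounded_linear_intro)
    show "response a b k1 k2 (h + h') = response a b k1 k2 h + response a b k1 k2 h'" for h h'
      unfolding response_def integral_add[OF response_integrable response_integrable, symmetric]
      by (rule integral_cong) (simp add: algebra_simps)
    show "response a b k1 k2 (r *\<^sub>R h) = r *\<^sub>R response a b k1 k2 h" for r h
      unfolding response_def integral_cmul[symmetric]
      by (rule integral_cong) (simp add: algebra_simps)
    show "norm (response a b k1 k2 h) \<le> norm h * ((B1 + B2) * (b - a))" for h
    proof -
      have "norm (response a b k1 k2 h) \<le> norm h * (B1 + B2) * (b - a)"
        unfolding response_def
      proof (rule integral_bound[OF ab])
        show "continuous_on {a..b} (\<lambda>t. fst (apply_bcontfun h t) *\<^sub>R k1 t + snd (apply_bcontfun h t) *\<^sub>R k2 t)"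
          by (intro continuous_intros k1 k2) auto
        show "norm (fst (apply_bcontfun h t) *\<^sub>R k1 t + snd (apply_bcontfun h t) *\<^sub>R k2 t) \<le> norm h * (B1 + B2)"
          if t: "t \<in> {a..b}" for t
        proof -
          have "norm (fst (apply_bcontfun h t) *\<^sub>R k1 t) \<le> norm h * B1"
            using norm_fst_le[of "fst (apply_bcontfun h t)" "snd (apply_bcontfun h t)"] norm_bounded[of h t]
            unfolding norm_scaleR by (intro mult_mono B1[OF t]) auto
          moreover have "norm (snd (apply_bcontfun h t) *\<^sub>R k2 t) \<le> norm h * B2"
            using norm_snd_le[of "snd (apply_bcontfun h t)" "fst (apply_bcontfun h t)"] norm_bounded[of h t]
            unfolding norm_scaleR by (intro mult_mono B2[OF t]) auto
          ultimately show ?thesis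
            by (intro order_trans[OF norm_triangle_ineq]) (simp add: distrib_left)
        qed
      qed
      then show ?thesis by (simp add: mult.assoc)
    qed
  qed
qed

text \<open>
  A linear map into a Euclidean space misses some vector if and only if its range is annihilated by a
  nonzero \<open>v\<close>.  Testing with the control \<open>(v \<bullet> k1, v \<bullet> k2)\<close> itself shows that \<open>v\<close> annihilates the range
  only if it annihilates both kernels at every instant.
\<close>

lemma response_surj_iff:
  assumes ab: "a < b"
  shows "range (response a b k1 k2) \<noteq> UNIV \<longleftrightarrow>
    (\<exists>v. v \<noteq> 0 \<and> (\<forall>t\<in>{a..b}. v \<bullet> k1 t = 0 \<and> v \<bullet> k2 t = 0))"
proof -
  have inner: "v \<bullet> response a b k1 k2 h =
      integral {a..b} (\<lambda>t. fst (apply_bcontfun h t) * (v \<bullet> k1 t) + snd (apply_bcontfun h t) * (v \<bullet> k2 t))"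
    for v h
    using response_linear_image[OF bounded_linear_inner_right[of v], of h] by simp
  show ?thesis
  proof
    assume "range (response a b k1 k2) \<noteq> UNIV"
    moreover have "subspace (range (response a b k1 k2))"
      using bounded_linear_response ab
      by (intro linear_subspace_image bounded_linear.linear subspace_UNIV) auto
    ultimately have "span (range (response a b k1 k2)) \<noteq> UNIV"
      by (metis span_eq_iff)
    then obtain v where v: "v \<noteq> 0" "\<And>x. x \<in> span (range (response a b k1 k2)) \<Longrightarrow> v \<bullet> x = 0"
      using span_not_UNIV_orthogonal by blast
    have c: "continuous_on {a..b} (\<lambda>t. (v \<bullet> k1 t, v \<bullet> k2 t))"
      by (intro continuous_intros k1 k2)
    obtain h :: control where h: "\<And>t. t \<in> {a..b} \<Longrightarrow> apply_bcontfun h t = (v \<bullet> k1 t, v \<bullet> k2 t)"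
      using continuous_on_bcontfun_extension[OF c] by blast
    have "0 = v \<bullet> response a b k1 k2 h"
      using v(2)[OF span_base] by simp
    also have "\<dots> = integral {a..b} (\<lambda>t. (v \<bullet> k1 t)\<^sup>2 + (v \<bullet> k2 t)\<^sup>2)"
      unfolding inner by (rule integral_cong) (simp add: h power2_eq_square)
    finally have "\<forall>t\<in>{a..b}. (v \<bullet> k1 t)\<^sup>2 + (v \<bullet> k2 t)\<^sup>2 = 0"
      using ab by (subst integral_eq_0_iff[symmetric]) (auto intro!: continuous_intros k1 k2)
    then show "\<exists>v. v \<noteq> 0 \<and> (\<forall>t\<in>{a..b}. v \<bullet> k1 t = 0 \<and> v \<bullet> k2 t = 0)"
      using v(1) by (auto simp: sum_power2_eq_zero_iff)
  next
    assume "\<exists>v. v \<noteq> 0 \<and> (\<forall>t\<in>{a..b}. v \<bullet> k1 t = 0 \<and> v \<bullet> k2 t = 0)"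
    then obtain v where v: "v \<noteq> 0" "\<And>t. t \<in> {a..b} \<Longrightarrow> v \<bullet> k1 t = 0 \<and> v \<bullet> k2 t = 0"
      by blast
    have "v \<bullet> response a b k1 k2 h = integral {a..b} (\<lambda>t. 0)" for h
      unfolding inner by (rule integral_cong) (simp add: v(2))
    then have "v \<notin> range (response a b k1 k2)"
      using v(1) by (metis imageE inner_eq_zero_iff integral_0)
    then show "range (response a b k1 k2) \<noteq> UNIV"
      by blast
  qed
qed

end

section \<open>The differential of the endpoint map\<close>

text \<open>
  In these coordinates a tangent vector is a velocity of \<open>x\<close> together with two angular velocities.
\<close>

lemma tangent_space_eq:
  "tangent_space q = range (\<lambda>(p, r1, r2). (p, r1 *\<^sub>R (\<i> * dir1 q), r2 *\<^sub>R (\<i> * dir2 q)))"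
proof -
  have "w \<in> tangent_space q \<longleftrightarrow> (\<exists>p r1 r2. w = (p, r1 *\<^sub>R (\<i> * dir1 q), r2 *\<^sub>R (\<i> * dir2 q)))" for w
  proof -
    have "w \<in> tangent_space q \<longleftrightarrow> (\<exists>a b r1 r2. w - a *\<^sub>R d_x1 q - b *\<^sub>R d_x2 q
        - r1 *\<^sub>R d_\<alpha>1 q - r2 *\<^sub>R d_\<alpha>2 q = 0)"
      unfolding tangent_space_def span_insert by (simp add: algebra_simps)
    also have "\<dots> \<longleftrightarrow> (\<exists>a b r1 r2. w = (Complex a b, r1 *\<^sub>R (\<i> * dir1 q), r2 *\<^sub>R (\<i> * dir2 q)))"
      by (cases w) (simp add: d_x1_def d_x2_def d_\<alpha>1_def d_\<alpha>2_def zero_prod_def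
          complex_eq_iff algebra_simps eq_neg_iff_add_eq_0)
    also have "\<dots> \<longleftrightarrow> (\<exists>p r1 r2. w = (p, r1 *\<^sub>R (\<i> * dir1 q), r2 *\<^sub>R (\<i> * dir2 q)))"
      by (metis complex.collapse)
    finally show ?thesis .
  qed
  then show ?thesis
    by (auto simp: image_iff)
qed

text \<open>
  The kernels describe how an impulse of \<open>x\<close> in the two coordinate directions at a given instant acts
  on \<open>x\<close> and on the two weighted angles; \<open>r1\<close> and \<open>r2\<close> are the weights at that instant.
\<close>

definition kernel_x1 :: "real \<Rightarrow> real \<Rightarrow> config \<Rightarrow> real \<Rightarrow> real \<Rightarrow> complex \<times> real \<times> real" where
  "kernel_x1 l1 l2 q r1 r2 = (1, - r1 * sin\<alpha>1 q / l1, - r2 * sin\<alpha>2 q / l2)"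

definition kernel_x2 :: "real \<Rightarrow> real \<Rightarrow> config \<Rightarrow> real \<Rightarrow> real \<Rightarrow> complex \<times> real \<times> real" where
  "kernel_x2 l1 l2 q r1 r2 = (\<i>, r1 * cos\<alpha>1 q / l1, r2 * cos\<alpha>2 q / l2)"

text \<open>
  From a displacement of \<open>x\<close> and two weighted angles back to a tangent vector at \<open>q\<close>.
\<close>

definition unweight :: "config \<Rightarrow> real \<Rightarrow> real \<Rightarrow> complex \<times> real \<times> real \<Rightarrow> config" where
  "unweight q r1 r2 = (\<lambda>(p, \<rho>1, \<rho>2). (p, (\<rho>1 / r1) *\<^sub>R (\<i> * dir1 q), (\<rho>2 / r2) *\<^sub>R (\<i> * dir2 q)))"

lemma kernel_combination:
  "c1 *\<^sub>R kernel_x1 l1 l2 q r1 r2 + c2 *\<^sub>R kernel_x2 l1 l2 q r1 r2 =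
    (Complex c1 c2, r1 * Im (cnj (dir1 q) * Complex c1 c2) / l1, r2 * Im (cnj (dir2 q) * Complex c1 c2) / l2)"
  by (simp add: kernel_x1_def kernel_x2_def complex_eq_iff diff_divide_distrib algebra_simps)

lemma bounded_linear_unweight: "bounded_linear (unweight q r1 r2)"
  unfolding unweight_def case_prod_beta divide_inverse
  by (intro bounded_linear_Pair bounded_linear_fst bounded_linear_intros
      bounded_linear_fst_comp bounded_linear_snd_comp)

lemma unweight_inject:
  assumes "norm (dir1 q) = 1" "norm (dir2 q) = 1" "r1 \<noteq> 0" "r2 \<noteq> 0"
  shows "inj (unweight q r1 r2)"
proof -
  have "dir1 q \<noteq> 0" "dir2 q \<noteq> 0"
    using assms by auto
  then show ?thesis
    using assms(3,4) by (auto simp: inj_def unweight_def)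
qed

lemma range_unweight:
  assumes "r1 \<noteq> 0" "r2 \<noteq> 0"
  shows "range (unweight q r1 r2) = tangent_space q"
proof -
  have "surj (\<lambda>(p, \<rho>1, \<rho>2). (p::complex, \<rho>1 / r1, \<rho>2 / r2))"
    by (rule surjI[where f = "\<lambda>(p, \<rho>1, \<rho>2). (p, \<rho>1 * r1, \<rho>2 * r2)"]) (use assms in auto)
  moreover have "unweight q r1 r2 =
      (\<lambda>(p, s1, s2). (p, s1 *\<^sub>R (\<i> * dir1 q), s2 *\<^sub>R (\<i> * dir2 q))) \<circ> (\<lambda>(p, \<rho>1, \<rho>2). (p, \<rho>1 / r1, \<rho>2 / r2))"
    by (auto simp: unweight_def)
  ultimately show ?thesis
    unfolding tangent_space_eq by (simp only: image_comp[symmetric])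
qed

context
  fixes l1 l2 a b :: real and u :: control and \<gamma> :: "real \<Rightarrow> config" and g1 g2 :: "real \<Rightarrow> real"
  assumes l: "l1 > 0" "l2 > 0" and ab: "a < b" and \<gamma>: "trajectory l1 l2 a b u \<gamma>"
    and g1: "towing_weight l1 a b (velocity u) (\<lambda>t. dir1 (\<gamma> t)) g1"
    and g2: "towing_weight l2 a b (velocity u) (\<lambda>t. dir2 (\<gamma> t)) g2"
begin

lemma directions_towed:
  "towed l1 a b (velocity u) (\<lambda>t. dir1 (\<gamma> t))" "towed l2 a b (velocity u) (\<lambda>t. dir2 (\<gamma> t))"
  using \<gamma> by (simp_all add: trajectory_iff[OF l])

abbreviation "kern1 t \<equiv> kernel_x1 l1 l2 (\<gamma> t) (g1 t) (g2 t)"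
abbreviation "kern2 t \<equiv> kernel_x2 l1 l2 (\<gamma> t) (g1 t) (g2 t)"

lemma kernels_continuous: "continuous_on {a..b} kern1" "continuous_on {a..b} kern2"
  unfolding kernel_x1_def kernel_x2_def divide_inverse
  by (intro continuous_intros towed_continuous[OF directions_towed(1)] towed_continuous[OF directions_towed(2)]
      towing_weight_continuous[OF g1] towing_weight_continuous[OF g2])+

lemma response_components:
  "response a b kern1 kern2 h = (integral {a..b} (velocity h),
    integral {a..b} (\<lambda>t. g1 t * Im (cnj (dir1 (\<gamma> t)) * velocity h t) / l1),
    integral {a..b} (\<lambda>t. g2 t * Im (cnj (dir2 (\<gamma> t)) * velocity h t) / l2))"
proof -
  have f: "f (response a b kern1 kern2 h) = integral {a..b} (\<lambda>t. f (velocity h t,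
      g1 t * Im (cnj (dir1 (\<gamma> t)) * velocity h t) / l1, g2 t * Im (cnj (dir2 (\<gamma> t)) * velocity h t) / l2))"
    if "bounded_linear f" for f :: "complex \<times> real \<times> real \<Rightarrow> 'b::euclidean_space"
  proof -
    interpret bounded_linear f by fact
    show ?thesis
      unfolding response_linear_image[OF kernels_continuous that] velocity_def
        kernel_combination[symmetric] add scaleR ..
  qed
  have "fst (response a b kern1 kern2 h) = integral {a..b} (velocity h)"
    using f[OF bounded_linear_fst] by simp
  moreover have "fst (snd (response a b kern1 kern2 h)) =
      integral {a..b} (\<lambda>t. g1 t * Im (cnj (dir1 (\<gamma> t)) * velocity h t) / l1)"
    using f[OF bounded_linear_compose[OF bounded_linear_fst bounded_linear_snd]] by (simp only: fst_conv snd_conv)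
  moreover have "snd (snd (response a b kern1 kern2 h)) =
      integral {a..b} (\<lambda>t. g2 t * Im (cnj (dir2 (\<gamma> t)) * velocity h t) / l2)"
    using f[OF bounded_linear_compose[OF bounded_linear_snd bounded_linear_snd]] by (simp only: snd_conv)
  ultimately show ?thesis
    by (simp only: prod_eq_iff fst_conv snd_conv simp_thms)
qed

text \<open>
  The three components are estimated separately: the position depends linearly on the control, and each
  direction has the expansion of a towed rod.
\<close>

lemma endpoint_map_has_derivative:
  "(endpoint_map l1 l2 a b (\<gamma> a) has_derivative
     (\<lambda>h. unweight (\<gamma> b) (g1 b) (g2 b) (response a b kern1 kern2 h))) (at u)" (is "(?F has_derivative ?E) _")
proof -
  have ab: "a \<le> b" using \<open>a < b\<close> by simp
  obtain K1 where K1: "K1 \<ge> 0" "\<forall>h w H. continuous_on {a..b} h \<longrightarrow>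
      towed l1 a b (\<lambda>t. velocity u t + h t) w \<longrightarrow> w a = dir1 (\<gamma> a) \<longrightarrow>
      (\<forall>t\<in>{a..b}. norm (h t) \<le> H) \<longrightarrow>
      norm (w b - dir1 (\<gamma> b) - (integral {a..b} (\<lambda>t. g1 t * Im (cnj (dir1 (\<gamma> t)) * h t) / l1) / g1 b)
        *\<^sub>R (\<i> * dir1 (\<gamma> b))) \<le> K1 * H\<^sup>2"
    using towed_expansion[OF ab l(1) velocity_continuous directions_towed(1) g1] by blast
  obtain K2 where K2: "K2 \<ge> 0" "\<forall>h w H. continuous_on {a..b} h \<longrightarrow>
      towed l2 a b (\<lambda>t. velocity u t + h t) w \<longrightarrow> w a = dir2 (\<gamma> a) \<longrightarrow>
      (\<forall>t\<in>{a..b}. norm (h t) \<le> H) \<longrightarrow>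
      norm (w b - dir2 (\<gamma> b) - (integral {a..b} (\<lambda>t. g2 t * Im (cnj (dir2 (\<gamma> t)) * h t) / l2) / g2 b)
        *\<^sub>R (\<i> * dir2 (\<gamma> b))) \<le> K2 * H\<^sup>2"
    using towed_expansion[OF ab l(2) velocity_continuous directions_towed(2) g2] by blast
  have bl: "bounded_linear ?E"
    using bounded_linear_compose[OF bounded_linear_unweight bounded_linear_response[OF kernels_continuous ab]]
    by (simp add: o_def)
  show ?thesis
  proof (rule has_derivativeI_sandwich[OF zero_less_one bl])
    fix y assume "y \<in> UNIV" "y \<noteq> u"
    define h where "h = y - u"
    have y: "y = u + h" and h0: "norm h > 0"
      using \<open>y \<noteq> u\<close> by (simp_all add: h_def)
    have "a \<in> {a..b}" using ab by simp
    then have "\<gamma> a \<in> config_space l1 l2"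
      using \<gamma> by (simp add: trajectory_def)
    then obtain \<eta> where \<eta>: "trajectory l1 l2 a b y \<eta>" and start: "\<eta> a = \<gamma> a"
      using trajectory_exists[OF l ab] by metis
    have ends: "?F y = \<eta> b" "?F u = \<gamma> b"
      using endpoint_map_trajectory[OF l ab \<eta>] endpoint_map_trajectory[OF l ab \<gamma>] start by simp_all
    have tow: "towed l1 a b (\<lambda>t. velocity u t + velocity h t) (\<lambda>t. dir1 (\<eta> t))"
      "towed l2 a b (\<lambda>t. velocity u t + velocity h t) (\<lambda>t. dir2 (\<eta> t))"
      using \<eta> unfolding trajectory_iff[OF l] y velocity_add[abs_def] by blast+
    have "integral {a..b} (velocity y) = integral {a..b} (velocity u) + integral {a..b} (velocity h)"
      unfolding y velocity_add[abs_def]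
      by (intro integral_add integrable_continuous_interval velocity_continuous)
    then have p: "pos (\<eta> b) - pos (\<gamma> b) = integral {a..b} (velocity h)"
      using trajectory_pos[OF l ab \<gamma>] trajectory_pos[OF l ab \<eta>] start by simp
    define e1 where "e1 = dir1 (\<eta> b) - dir1 (\<gamma> b) -
      (integral {a..b} (\<lambda>t. g1 t * Im (cnj (dir1 (\<gamma> t)) * velocity h t) / l1) / g1 b) *\<^sub>R (\<i> * dir1 (\<gamma> b))"
    define e2 where "e2 = dir2 (\<eta> b) - dir2 (\<gamma> b) -
      (integral {a..b} (\<lambda>t. g2 t * Im (cnj (dir2 (\<gamma> t)) * velocity h t) / l2) / g2 b) *\<^sub>R (\<i> * dir2 (\<gamma> b))"
    have "norm e1 \<le> K1 * (norm h)\<^sup>2"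
      unfolding e1_def by (rule K1(2)[rule_format, OF velocity_continuous tow(1)]) (simp_all add: start norm_velocity_le)
    moreover have "norm e2 \<le> K2 * (norm h)\<^sup>2"
      unfolding e2_def by (rule K2(2)[rule_format, OF velocity_continuous tow(2)]) (simp_all add: start norm_velocity_le)
    moreover have "?F y - ?F u - ?E (y - u) = (0, e1, e2)"
      unfolding ends h_def[symmetric] unfolding response_components unweight_def by (simp add: prod_eq_iff p e1_def e2_def del: times_complex.sel)
    moreover have "norm (0::complex, e1, e2) \<le> norm e1 + norm e2"
      using norm_Pair_le[of "0::complex" "(e1, e2)"] norm_Pair_le[of e1 e2] by simp
    ultimately have "norm (?F y - ?F u - ?E (y - u)) \<le> (K1 + K2) * norm h * norm h"
      by (simp add: algebra_simps power2_eq_square)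
    then show "norm (?F y - ?F u - ?E (y - u)) / norm (y - u) \<le> (K1 + K2) * norm (y - u)"
      using h0 unfolding h_def[symmetric] by (simp add: divide_le_eq)
  next
    have "((\<lambda>y. (K1 + K2) * norm (y - u)) \<longlongrightarrow> (K1 + K2) * norm (u - u)) (at u)"
      by (intro tendsto_intros)
    then show "((\<lambda>y. (K1 + K2) * norm (y - u)) \<longlongrightarrow> 0) (at u)"
      by simp
  qed
qed

text \<open>
  The abnormal covector: criticality of the endpoint map means that some nonzero \<open>(p, \<mu>1, \<mu>2)\<close> annihilates
  the effect of every impulse along the curve.  The two real conditions, one for each coordinate
  direction of the impulse, are the real and the imaginary part of one complex equation.
\<close>

lemma derivative_not_onto_iff:
  "(\<exists>E. (endpoint_map l1 l2 a b (\<gamma> a) has_derivative E) (at u) \<and> range E \<noteq> tangent_space (\<gamma> b)) \<longleftrightarrow>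
   (\<exists>p \<mu>1 \<mu>2. (p, \<mu>1, \<mu>2) \<noteq> 0 \<and> (\<forall>t\<in>{a..b}.
      p + \<i> * (of_real (\<mu>1 / l1) * (of_real (g1 t) * dir1 (\<gamma> t)) + of_real (\<mu>2 / l2) * (of_real (g2 t) * dir2 (\<gamma> t))) = 0))"
proof -
  let ?J = "unweight (\<gamma> b) (g1 b) (g2 b)" and ?A = "response a b kern1 kern2"
  have b: "b \<in> {a..b}" using ab by simp
  have "g1 b > 0" "g2 b > 0"
    using g1 g2 b by (simp_all only: towing_weight_def)
  then have g0: "g1 b \<noteq> 0" "g2 b \<noteq> 0"
    by simp_all
  have n: "norm (dir1 (\<gamma> b)) = 1" "norm (dir2 (\<gamma> b)) = 1"
    using directions_towed b by (auto simp only: towed_def)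
  have key: "(p, \<mu>1, \<mu>2) \<bullet> kern1 t = 0 \<and> (p, \<mu>1, \<mu>2) \<bullet> kern2 t = 0 \<longleftrightarrow>
      p + \<i> * (of_real (\<mu>1 / l1) * (of_real (g1 t) * dir1 (\<gamma> t)) + of_real (\<mu>2 / l2) * (of_real (g2 t) * dir2 (\<gamma> t))) = 0"
    for p \<mu>1 \<mu>2 t
    by (simp add: kernel_x1_def kernel_x2_def complex_eq_iff inner_complex_def algebra_simps)
  have "(\<exists>E. (endpoint_map l1 l2 a b (\<gamma> a) has_derivative E) (at u) \<and> range E \<noteq> tangent_space (\<gamma> b))
      \<longleftrightarrow> range (\<lambda>h. ?J (?A h)) \<noteq> tangent_space (\<gamma> b)"
    using endpoint_map_has_derivative has_derivative_unique by blast
  also have "\<dots> \<longleftrightarrow> ?J ` range ?A \<noteq> ?J ` UNIV"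
    by (simp only: range_unweight[OF g0] image_image)
  also have "\<dots> \<longleftrightarrow> range ?A \<noteq> UNIV"
    by (simp only: inj_image_eq_iff[OF unweight_inject[OF n g0]])
  also have "\<dots> \<longleftrightarrow> (\<exists>v. v \<noteq> 0 \<and> (\<forall>t\<in>{a..b}. v \<bullet> kern1 t = 0 \<and> v \<bullet> kern2 t = 0))"
    by (rule response_surj_iff[OF kernels_continuous ab])
  also have "\<dots> \<longleftrightarrow> (\<exists>p \<mu>1 \<mu>2. (p, \<mu>1, \<mu>2) \<noteq> 0 \<and> (\<forall>t\<in>{a..b}.
      p + \<i> * (of_real (\<mu>1 / l1) * (of_real (g1 t) * dir1 (\<gamma> t)) + of_real (\<mu>2 / l2) * (of_real (g2 t) * dir2 (\<gamma> t))) = 0))"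
    by (simp only: split_paired_Ex key)
  finally show ?thesis .
qed

end

section \<open>Abnormal covectors and the characteristic field\<close>

text \<open>
  Identities along a curve are differentiated with this; one-sided derivatives at the ends are included.
\<close>

lemma vector_derivative_zero_on_interval:
  assumes "a < b" "t \<in> {a..b}" "\<And>s. s \<in> {a..b} \<Longrightarrow> f s = 0"
    and "(f has_vector_derivative f') (at t within {a..b})"
  shows "f' = 0"
proof -
  have "(f has_vector_derivative 0) (at t within {a..b})"
    using has_vector_derivative_transform[of t "{a..b}" f "\<lambda>_. 0" 0] assms(2,3) by simp
  then show ?thesis
    using vector_derivative_unique_within_closed_interval[of a b t f f' 0] assms by simp
qed

text \<open>
  Since \<open>(g\<^sub>i z\<^sub>i)' = g\<^sub>i u / l\<^sub>i\<close> and \<open>u\<close> never vanishes, differentiating the covector equation once gives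
  \<open>\<mu>1 g1 / l1\<^sup>2 + \<mu>2 g2 / l2\<^sup>2 = 0\<close>, and differentiating again shows that \<open>g1\<close> and \<open>g2\<close> grow at the same
  relative rate.  Conversely, equal growth rates mean \<open>g1 = g2\<close>, so that \<open>l1 g1 z1 - l2 g2 z2\<close> is constant,
  and this constant provides the covector.
\<close>

lemma covector_iff_balanced:
  assumes l: "l1 > 0" "l2 > 0" and ab: "a < b"
    and z1: "towed l1 a b u z1" and z2: "towed l2 a b u z2"
    and g1: "towing_weight l1 a b u z1 g1" and g2: "towing_weight l2 a b u z2 g2"
    and u0: "\<And>t. t \<in> {a..b} \<Longrightarrow> u t \<noteq> 0"
  shows "(\<exists>p \<mu>1 \<mu>2. (p, \<mu>1, \<mu>2) \<noteq> 0 \<and> (\<forall>t\<in>{a..b}.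
      p + \<i> * (of_real (\<mu>1 / l1) * (of_real (g1 t) * z1 t) + of_real (\<mu>2 / l2) * (of_real (g2 t) * z2 t)) = 0))
    \<longleftrightarrow> (\<forall>t\<in>{a..b}. Re (cnj (z1 t) * u t) / l1 = Re (cnj (z2 t) * u t) / l2)" (is "?L \<longleftrightarrow> ?R")
proof -
  note d1 = towing_weight_direction[OF z1 g1] and d2 = towing_weight_direction[OF z2 g2]
  have dg1: "(g1 has_real_derivative g1 t * Re (cnj (z1 t) * u t) / l1) (at t within {a..b})" and pos1: "g1 t > 0"
    and dg2: "(g2 has_real_derivative g2 t * Re (cnj (z2 t) * u t) / l2) (at t within {a..b})" and pos2: "g2 t > 0"
    if "t \<in> {a..b}" for t
    using that g1 g2 by (simp_all only: towing_weight_def)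
  have ?R if ?L
  proof -
    from that obtain p \<mu>1 \<mu>2 where ne: "(p, \<mu>1, \<mu>2) \<noteq> 0" and eq: "\<And>t. t \<in> {a..b} \<Longrightarrow>
        p + \<i> * (of_real (\<mu>1 / l1) * (of_real (g1 t) * z1 t) + of_real (\<mu>2 / l2) * (of_real (g2 t) * z2 t)) = 0"
      by blast
    define S where "S t = \<mu>1 / l1\<^sup>2 * g1 t + \<mu>2 / l2\<^sup>2 * g2 t" for t
    have S0: "S t = 0" if t: "t \<in> {a..b}" for t
    proof -
      have "((\<lambda>t. p + \<i> * (of_real (\<mu>1 / l1) * (of_real (g1 t) * z1 t) + of_real (\<mu>2 / l2) * (of_real (g2 t) * z2 t)))
          has_vector_derivative 0 + \<i> * (of_real (\<mu>1 / l1) * (of_real (g1 t / l1) * u t)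
            + of_real (\<mu>2 / l2) * (of_real (g2 t / l2) * u t))) (at t within {a..b})"
        by (intro has_vector_derivative_add has_vector_derivative_const has_vector_derivative_mult_right d1 d2 t)
      from vector_derivative_zero_on_interval[OF ab t eq this]
      have "\<i> * (of_real (\<mu>1 / l1) * (of_real (g1 t / l1) * u t) + of_real (\<mu>2 / l2) * (of_real (g2 t / l2) * u t)) = 0"
        by simp
      moreover have "of_real (\<mu>1 / l1) * (of_real (g1 t / l1) * u t) + of_real (\<mu>2 / l2) * (of_real (g2 t / l2) * u t)
          = of_real (S t) * u t"
        by (simp add: S_def distrib_right power2_eq_square mult.assoc)
      ultimately show ?thesis
        using u0[OF t] by simp
    qed
    show ?R
    proof
      fix t assume t: "t \<in> {a..b}"
      define k1 k2 where "k1 = Re (cnj (z1 t) * u t) / l1" and "k2 = Re (cnj (z2 t) * u t) / l2"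
      have "(S has_real_derivative \<mu>1 / l1\<^sup>2 * (g1 t * k1) + \<mu>2 / l2\<^sup>2 * (g2 t * k2)) (at t within {a..b})"
        unfolding S_def k1_def k2_def times_divide_eq_right[of "g1 t"] times_divide_eq_right[of "g2 t"]
        by (intro DERIV_add DERIV_cmult dg1 dg2 t)
      then have "\<mu>1 / l1\<^sup>2 * (g1 t * k1) + \<mu>2 / l2\<^sup>2 * (g2 t * k2) = 0"
        using vector_derivative_zero_on_interval[OF ab t S0] 
        by (simp only: has_real_derivative_iff_has_vector_derivative)
      moreover have "A * x * (k1 - k2) + (A * x + B * y) * k2 = A * (x * k1) + B * (y * k2)" for A B x y
        by (simp add: algebra_simps)
      ultimately have "\<mu>1 / l1\<^sup>2 * g1 t * (k1 - k2) + S t * k2 = 0"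
        by (simp only: S_def)
      then have prod: "\<mu>1 * (k1 - k2) = 0"
        using S0[OF t] pos1[OF t] l by simp
      \<comment> \<open>If \<open>\<mu>1\<close> vanished, then so would \<open>\<mu>2\<close> and finally \<open>p\<close>.\<close>
      have "\<mu>1 \<noteq> 0"
      proof
        assume 0: "\<mu>1 = 0"
        then have "\<mu>2 = 0"
          using S0[OF t] pos2[OF t] l by (simp add: S_def)
        then show False
          using eq[OF t] ne 0 by (simp add: zero_prod_def)
      qed
      then show "Re (cnj (z1 t) * u t) / l1 = Re (cnj (z2 t) * u t) / l2"
        using prod by (simp add: k1_def k2_def)
    qed
  qed
  moreover have ?L if bal: ?R
  proof -
    have "((\<lambda>t. g1 t / g2 t) has_real_derivative 0) (at t within {a..b})" if t: "t \<in> {a..b}" for t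
    proof -
      define k where "k = Re (cnj (z1 t) * u t) / l1"
      have "Re (cnj (z2 t) * u t) / l2 = k"
        using bal t by (simp only: k_def)
      then have "(g1 has_real_derivative g1 t * k) (at t within {a..b})"
        "(g2 has_real_derivative g2 t * k) (at t within {a..b})"
        using dg1[OF t] dg2[OF t] by (simp_all only: k_def times_divide_eq_right[symmetric])
      from DERIV_divide[OF this] show ?thesis
        using pos2[OF t] by (simp add: mult_ac)
    qed
    then obtain c where c: "\<And>t. t \<in> {a..b} \<Longrightarrow> g1 t / g2 t = c"
      using has_field_derivative_zero_constant[of "{a..b}" "\<lambda>t. g1 t / g2 t"] by auto
    have "g1 a / g2 a = 1"
      using g1 g2 by (simp add: towing_weight_def)
    then have "c = 1"
      using c[of a] ab by simp
    then have geq: "g1 t = g2 t" if "t \<in> {a..b}" for t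
      using c[OF that] pos2[OF that] by (simp add: divide_eq_1_iff)
    define M where "M t = of_real l1 * (of_real (g1 t) * z1 t) - of_real l2 * (of_real (g2 t) * z2 t)" for t
    have dM: "(M has_vector_derivative 0) (at t within {a..b})" if t: "t \<in> {a..b}" for t
    proof -
      have "(M has_vector_derivative of_real l1 * (of_real (g1 t / l1) * u t) - of_real l2 * (of_real (g2 t / l2) * u t))
          (at t within {a..b})"
        unfolding M_def by (intro has_vector_derivative_diff has_vector_derivative_mult_right d1 d2 t)
      then show ?thesis
        using geq[OF t] l by simp
    qed
    obtain m where m: "\<And>t. t \<in> {a..b} \<Longrightarrow> M t = m"
      using has_vector_derivative_zero_constant[of "{a..b}" M] dM by auto
    show ?L
    proof (intro exI conjI ballI)
      show "(- \<i> * m, l1\<^sup>2, - (l2\<^sup>2)) \<noteq> 0"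
        using l by (simp add: zero_prod_def)
      fix t assume t: "t \<in> {a..b}"
      have "of_real (l1\<^sup>2 / l1) * (of_real (g1 t) * z1 t) + of_real (- (l2\<^sup>2) / l2) * (of_real (g2 t) * z2 t) = M t"
        using l by (simp add: M_def power2_eq_square)
      then show "- \<i> * m + \<i> * (of_real (l1\<^sup>2 / l1) * (of_real (g1 t) * z1 t)
          + of_real (- (l2\<^sup>2) / l2) * (of_real (g2 t) * z2 t)) = 0"
        using m[OF t] by simp
    qed
  qed
  ultimately show ?thesis
    by blast
qed

text \<open>
  The velocity of \<open>x\<close> along the field \<open>\<xi>\<close>: the vector \<open>z1 / l1 - z2 / l2\<close> turned by a right angle.
\<close>

definition xi_velocity :: "real \<Rightarrow> real \<Rightarrow> config \<Rightarrow> complex" where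
  "xi_velocity l1 l2 q = - \<i> * (dir1 q /\<^sub>R l1 - dir2 q /\<^sub>R l2)"

lemma xi_eq: "xi l1 l2 q = Re (xi_velocity l1 l2 q) *\<^sub>R v1 l1 l2 q + Im (xi_velocity l1 l2 q) *\<^sub>R v2 l1 l2 q"
proof -
  have "Re (xi_velocity l1 l2 q) = sin\<alpha>1 q / l1 - sin\<alpha>2 q / l2"
    "Im (xi_velocity l1 l2 q) = - (cos\<alpha>1 q / l1 - cos\<alpha>2 q / l2)"
    by (simp_all add: xi_velocity_def divide_inverse_commute)
  then show ?thesis
    by (simp only: xi_def scaleR_minus_left diff_conv_add_uminus)
qed

text \<open>
  If \<open>z1 / l1 = z2 / l2\<close> for unit vectors, then \<open>l1 = l2\<close> and \<open>z1 = z2\<close>, which is the locus \<open>m\<^sub>1 = m\<^sub>2\<close>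
  removed from the configuration space.
\<close>

lemma xi_velocity_nonzero:
  assumes l: "l1 > 0" "l2 > 0" and q: "q \<in> config_space l1 l2"
  shows "xi_velocity l1 l2 q \<noteq> 0"
proof
  assume "xi_velocity l1 l2 q = 0"
  then have eq: "dir1 q /\<^sub>R l1 = dir2 q /\<^sub>R l2"
    by (simp add: xi_velocity_def)
  have n: "norm (dir1 q) = 1" "norm (dir2 q) = 1"
    using q by (simp_all add: config_space_iff[OF l])
  have "l1 = l2"
    using arg_cong[OF eq, of norm] n l by simp
  moreover from this have "dir1 q = dir2 q"
    using eq l by simp
  ultimately show False
    using q unfolding config_space_iff[OF l] by blast
qed

text \<open>
  Equality of the growth rates says that \<open>c\<close> is orthogonal to \<open>z1 / l1 - z2 / l2\<close>, that is, parallel to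
  the velocity of \<open>\<xi>\<close>; the real factor is then found by orthogonal projection.
\<close>

lemma balanced_iff_parallel:
  assumes w: "xi_velocity l1 l2 q \<noteq> 0"
  shows "Re (cnj (dir1 q) * c) / l1 = Re (cnj (dir2 q) * c) / l2 \<longleftrightarrow>
    c = of_real ((c \<bullet> xi_velocity l1 l2 q) / (norm (xi_velocity l1 l2 q))\<^sup>2) * xi_velocity l1 l2 q"
    (is "_ \<longleftrightarrow> c = of_real (_ / (norm ?w)\<^sup>2) * _")
proof -
  have "Re (cnj (dir1 q) * c) / l1 - Re (cnj (dir2 q) * c) / l2 = Im (cnj ?w * c)"
    by (simp add: xi_velocity_def divide_inverse_commute algebra_simps)
  then have "Re (cnj (dir1 q) * c) / l1 = Re (cnj (dir2 q) * c) / l2 \<longleftrightarrow> Im (cnj ?w * c) = 0"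
    by linarith
  also have "\<dots> \<longleftrightarrow> cnj ?w * c = of_real (c \<bullet> ?w)"
    by (auto simp: complex_eq_iff inner_complex_def)
  also have "\<dots> \<longleftrightarrow> c = of_real ((c \<bullet> ?w) / (norm ?w)\<^sup>2) * ?w"
  proof -
    have n: "cnj ?w * ?w = of_real ((norm ?w)\<^sup>2)"
      by (simp add: complex_norm_square[symmetric] mult.commute[of "cnj _"])
    have "c = of_real ((c \<bullet> ?w) / (norm ?w)\<^sup>2) * ?w \<longleftrightarrow>
        cnj ?w * c = cnj ?w * (of_real ((c \<bullet> ?w) / (norm ?w)\<^sup>2) * ?w)"
      using mult_left_cancel[of "cnj ?w"] w by (simp only: complex_cnj_zero_iff not_False_eq_True)
    also have "cnj ?w * (of_real ((c \<bullet> ?w) / (norm ?w)\<^sup>2) * ?w) = of_real ((c \<bullet> ?w) / (norm ?w)\<^sup>2) * (cnj ?w * ?w)"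
      by (simp only: mult_ac)
    also have "\<dots> = of_real (c \<bullet> ?w)"
      unfolding n of_real_mult[symmetric] using w by simp
    finally show ?thesis by blast
  qed
  finally show ?thesis .
qed

section \<open>Singular curves and integral curves\<close>

text \<open>
  The integral \<open>\<phi>\<close> of the factor \<open>r\<close> is the new time.  As \<open>r\<close> has no zero, Rolle's theorem makes \<open>\<phi>\<close>
  injective whatever the sign of \<open>r\<close>, and \<open>\<gamma> \<circ> \<phi>\<^sup>-\<^sup>1\<close> is the integral curve.
\<close>

lemma reparametrized_integral_curve:
  fixes \<gamma> :: "real \<Rightarrow> config"
  assumes ab: "a < b" and r: "continuous_on {a..b} r" and r0: "\<And>t. t \<in> {a..b} \<Longrightarrow> r t \<noteq> 0"
    and S: "\<And>t. t \<in> {a..b} \<Longrightarrow> \<gamma> t \<in> S"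
    and \<gamma>: "\<And>t. t \<in> {a..b} \<Longrightarrow> (\<gamma> has_vector_derivative r t *\<^sub>R X (\<gamma> t)) (at t within {a..b})"
  shows "\<exists>c d \<sigma>. c < d \<and> integral_curve X S c d \<sigma> \<and> reparametrization a b \<gamma> c d \<sigma>"
proof -
  define \<phi> where "\<phi> t = integral {a..t} r" for t
  have \<phi>: "(\<phi> has_real_derivative r t) (at t within {a..b})" if "t \<in> {a..b}" for t
    unfolding \<phi>_def by (rule integral_has_real_derivative[OF r that])
  have \<phi>_cont: "continuous_on {a..b} \<phi>"
    using \<phi> by (rule DERIV_continuous_on)
  have ne: "\<phi> s \<noteq> \<phi> t" if st: "s \<in> {a..b}" "t \<in> {a..b}" "s < t" for s t
  proof
    assume eq: "\<phi> s = \<phi> t"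
    have sub: "{s..t} \<subseteq> {a..b}" using st by auto
    have deriv: "(\<phi> has_derivative (\<lambda>h. h * r x)) (at x)" if x: "s < x" "x < t" for x
    proof -
      have "x \<in> interior {a..b}" "x \<in> {a..b}"
        using x st by (auto simp: interior_atLeastAtMost_real)
      then have "(\<phi> has_real_derivative r x) (at x)"
        using \<phi>[of x] at_within_interior[of x "{a..b}"] by simp
      then show ?thesis
        by (simp only: has_field_derivative_def mult_commute_abs)
    qed
    obtain x where x: "s < x" "x < t" "\<phi> t - \<phi> s = (t - s) * r x"
      by (rule mvt[OF st(3) continuous_on_subset[OF \<phi>_cont sub] deriv])
    then have "r x = 0"
      using eq by simp
    then show False
      using r0[of x] st x by simp
  qed
  have inj: "inj_on \<phi> {a..b}"
    using ne by (intro inj_onI) (metis linorder_neq_iff)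
  obtain c d where im: "\<phi> ` {a..b} = {c..d}" and "c \<le> d"
    using continuous_image_closed_interval[OF less_imp_le[OF ab] \<phi>_cont] by blast
  have "\<phi> a \<noteq> \<phi> b" "\<phi> a \<in> {c..d}" "\<phi> b \<in> {c..d}"
    using ne[of a b] ab unfolding im[symmetric] by auto
  then have "c < d"
    by auto
  define \<psi> where "\<psi> = the_inv_into {a..b} \<phi>"
  have \<psi>\<phi>: "\<psi> (\<phi> t) = t" if "t \<in> {a..b}" for t
    unfolding \<psi>_def by (rule the_inv_into_f_f[OF inj that])
  have \<psi>_cont: "continuous_on {c..d} \<psi>"
    unfolding im[symmetric] using \<psi>\<phi> by (intro continuous_on_inv[OF \<phi>_cont]) auto
  have \<psi>_im: "\<psi> ` {c..d} = {a..b}"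
    unfolding im[symmetric] image_image using \<psi>\<phi> by simp
  have \<psi>: "(\<psi> has_vector_derivative inverse (r t)) (at (\<phi> t) within {c..d})" if t: "t \<in> {a..b}" for t
  proof -
    have "\<phi> t \<in> {c..d}" using t im by blast
    then have "continuous (at (\<phi> t) within {c..d}) \<psi>"
      using \<psi>_cont by (simp add: continuous_on_eq_continuous_within)
    moreover have "linear (\<lambda>h. h *\<^sub>R inverse (r t))"
      by (intro bounded_linear.linear bounded_linear_scaleR_left)
    ultimately have "(\<psi> has_derivative (\<lambda>h. h *\<^sub>R inverse (r t))) (at (\<phi> t) within \<phi> ` {a..b})"
      using \<phi>[OF t] r0[OF t] t \<psi>\<phi>
      by (intro has_derivative_inverse_within[of \<phi> "(*) (r t)"])
        (auto simp: has_field_derivative_def im fun_eq_iff)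
    then show ?thesis
      by (simp add: has_vector_derivative_def im)
  qed
  have "integral_curve X S c d (\<gamma> \<circ> \<psi>)"
    unfolding integral_curve_def
  proof (intro ballI conjI)
    fix y assume "y \<in> {c..d}"
    then obtain t where t: "t \<in> {a..b}" and y: "y = \<phi> t"
      unfolding im[symmetric] by blast
    show "(\<gamma> \<circ> \<psi>) y \<in> S"
      using S[OF t] by (simp add: y \<psi>\<phi>[OF t])
    have "(\<gamma> \<circ> \<psi> has_vector_derivative inverse (r t) *\<^sub>R (r t *\<^sub>R X (\<gamma> t))) (at y within {c..d})"
      unfolding y by (rule vector_diff_chain_within[OF \<psi>[OF t]]) (use \<gamma>[OF t] in \<open>simp add: \<psi>_im \<psi>\<phi>[OF t]\<close>)
    then show "(\<gamma> \<circ> \<psi> has_vector_derivative X ((\<gamma> \<circ> \<psi>) y)) (at y within {c..d})"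
      using r0[OF t] by (simp add: y \<psi>\<phi>[OF t])
  qed
  moreover have "reparametrization a b \<gamma> c d (\<gamma> \<circ> \<psi>)"
    unfolding reparametrization_def
    by (rule exI[of _ \<phi>], rule exI[of _ r]) (use r im \<phi> r0 \<psi>\<phi> in auto)
  ultimately show ?thesis
    using \<open>c < d\<close> by blast
qed

lemma xi_velocity_continuous:
  assumes \<gamma>: "continuous_on S \<gamma>"
  shows "continuous_on S (\<lambda>t. xi_velocity l1 l2 (\<gamma> t))"
  unfolding xi_velocity_def by (intro continuous_intros \<gamma>)

text \<open>
  Criticality of the endpoint map at a control is hence a pointwise condition on the velocity.
\<close>

lemma singular_trajectory_iff:
  assumes l: "l1 > 0" "l2 > 0" and ab: "a < b" and \<gamma>: "trajectory l1 l2 a b u \<gamma>"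
    and u0: "\<And>t. t \<in> {a..b} \<Longrightarrow> velocity u t \<noteq> 0"
  shows "(\<exists>E. (endpoint_map l1 l2 a b (\<gamma> a) has_derivative E) (at u) \<and> range E \<noteq> tangent_space (\<gamma> b)) \<longleftrightarrow>
    (\<forall>t\<in>{a..b}. velocity u t =
      of_real ((velocity u t \<bullet> xi_velocity l1 l2 (\<gamma> t)) / (norm (xi_velocity l1 l2 (\<gamma> t)))\<^sup>2) * xi_velocity l1 l2 (\<gamma> t))"
proof -
  have tow: "towed l1 a b (velocity u) (\<lambda>t. dir1 (\<gamma> t))" "towed l2 a b (velocity u) (\<lambda>t. dir2 (\<gamma> t))"
    using \<gamma> by (simp_all add: trajectory_iff[OF l])
  obtain g1 where g1: "towing_weight l1 a b (velocity u) (\<lambda>t. dir1 (\<gamma> t)) g1"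
    using towing_weight_exists[OF velocity_continuous tow(1)] by blast
  obtain g2 where g2: "towing_weight l2 a b (velocity u) (\<lambda>t. dir2 (\<gamma> t)) g2"
    using towing_weight_exists[OF velocity_continuous tow(2)] by blast
  have w: "xi_velocity l1 l2 (\<gamma> t) \<noteq> 0" if "t \<in> {a..b}" for t
    using xi_velocity_nonzero[OF l] \<gamma> that by (simp add: trajectory_def)
  show ?thesis
    by (rule trans[OF derivative_not_onto_iff[OF l ab \<gamma> g1 g2]
          trans[OF covector_iff_balanced[OF l ab tow g1 g2 u0]]])
      (assumption, intro ball_cong refl balanced_iff_parallel w)
qed

text \<open>
  A singular curve satisfies \<open>\<gamma>' = r \<xi>(\<gamma>)\<close> with a continuous \<open>r\<close> that has no zero, and a change of time
  removes the factor.  Conversely, the chain rule exhibits a reparametrized integral curve as the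
  trajectory of the control with velocity \<open>r\<close> times that of \<open>\<xi>\<close>.
\<close>

theorem theorem3:
  fixes l1 l2 a b :: real and \<gamma> :: "real \<Rightarrow> config"
  assumes "l1 > 0" and "l2 > 0" and "a < b"
  shows "singular_curve l1 l2 a b \<gamma> \<longleftrightarrow>
    (\<exists>c d \<sigma>. c < d \<and> integral_curve (xi l1 l2) (config_space l1 l2) c d \<sigma> \<and>
       reparametrization a b \<gamma> c d \<sigma>)"
proof
  note l = assms(1,2) and ab = assms(3)
  assume sing: "singular_curve l1 l2 a b \<gamma>"
  then obtain u where \<gamma>: "trajectory l1 l2 a b u \<gamma>"
    and E: "\<exists>E. (endpoint_map l1 l2 a b (\<gamma> a) has_derivative E) (at u) \<and> range E \<noteq> tangent_space (\<gamma> b)"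
    unfolding singular_curve_def by blast
  obtain \<gamma>' where \<gamma>': "\<And>t. t \<in> {a..b} \<Longrightarrow> (\<gamma> has_vector_derivative \<gamma>' t) (at t within {a..b})"
    "\<And>t. t \<in> {a..b} \<Longrightarrow> \<gamma>' t \<noteq> 0"
    using sing unfolding singular_curve_def regular_horizontal_curve_def by blast
  have \<gamma>_deriv: "(\<gamma> has_vector_derivative Re (velocity u t) *\<^sub>R v1 l1 l2 (\<gamma> t) + Im (velocity u t) *\<^sub>R v2 l1 l2 (\<gamma> t))
      (at t within {a..b})" and conf: "\<gamma> t \<in> config_space l1 l2" if "t \<in> {a..b}" for t
    using \<gamma> that by (simp_all add: trajectory_def velocity_def)
  have u0: "velocity u t \<noteq> 0" if t: "t \<in> {a..b}" for t
  proof
    assume "velocity u t = 0"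
    then have "(\<gamma> has_vector_derivative 0) (at t within {a..b})"
      using \<gamma>_deriv[OF t] by simp
    then show False
      using vector_derivative_unique_within_closed_interval[of a b t \<gamma> "\<gamma>' t" 0] ab t \<gamma>' by simp
  qed
  define w where "w t = xi_velocity l1 l2 (\<gamma> t)" for t
  define r where "r t = (velocity u t \<bullet> w t) / (norm (w t))\<^sup>2" for t
  have w0: "w t \<noteq> 0" if "t \<in> {a..b}" for t
    unfolding w_def by (rule xi_velocity_nonzero[OF l conf[OF that]])
  have u_eq: "velocity u t = of_real (r t) * w t" if "t \<in> {a..b}" for t
    using singular_trajectory_iff[OF l ab \<gamma> u0] E that unfolding w_def[symmetric] r_def[symmetric] by blast
  have \<gamma>_cont: "continuous_on {a..b} \<gamma>"
    using \<gamma>'(1) by (metis continuous_on_eq_continuous_within has_vector_derivative_continuous)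
  show "\<exists>c d \<sigma>. c < d \<and> integral_curve (xi l1 l2) (config_space l1 l2) c d \<sigma> \<and> reparametrization a b \<gamma> c d \<sigma>"
  proof (rule reparametrized_integral_curve[OF ab])
    show "continuous_on {a..b} r"
      unfolding r_def w_def using w0
      by (intro continuous_intros velocity_continuous xi_velocity_continuous[OF \<gamma>_cont]) (auto simp: w_def)
    show "r t \<noteq> 0" if "t \<in> {a..b}" for t
      using u_eq[OF that] u0[OF that] by auto
    show "\<gamma> t \<in> config_space l1 l2" if "t \<in> {a..b}" for t
      by (rule conf[OF that])
    show "(\<gamma> has_vector_derivative r t *\<^sub>R xi l1 l2 (\<gamma> t)) (at t within {a..b})" if "t \<in> {a..b}" for t
      using \<gamma>_deriv[OF that] unfolding u_eq[OF that] xi_eq w_def[symmetric] by (simp add: scaleR_add_right)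
  qed
next
  note l = assms(1,2) and ab = assms(3)
  assume "\<exists>c d \<sigma>. c < d \<and> integral_curve (xi l1 l2) (config_space l1 l2) c d \<sigma> \<and> reparametrization a b \<gamma> c d \<sigma>"
  then obtain c d \<sigma> where \<sigma>: "integral_curve (xi l1 l2) (config_space l1 l2) c d \<sigma>"
    and "reparametrization a b \<gamma> c d \<sigma>"
    by blast
  then obtain \<phi> r where r: "continuous_on {a..b} r" and im: "\<phi> ` {a..b} = {c..d}"
    and rep: "\<forall>t\<in>{a..b}. (\<phi> has_real_derivative r t) (at t within {a..b}) \<and> r t \<noteq> 0 \<and> \<gamma> t = \<sigma> (\<phi> t)"
    unfolding reparametrization_def by (elim exE conjE)
  note \<phi> = bspec[OF rep]
  define w where "w t = xi_velocity l1 l2 (\<gamma> t)" for t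
  have conf: "\<gamma> t \<in> config_space l1 l2" if t: "t \<in> {a..b}" for t
    using \<phi>[OF t] \<sigma> im t unfolding integral_curve_def by auto
  have \<gamma>_xi: "(\<gamma> has_vector_derivative r t *\<^sub>R xi l1 l2 (\<gamma> t)) (at t within {a..b})" if t: "t \<in> {a..b}" for t
  proof -
    have "\<phi> t \<in> {c..d}" using im t by blast
    then have "(\<sigma> has_vector_derivative xi l1 l2 (\<gamma> t)) (at (\<phi> t) within \<phi> ` {a..b})"
      using \<sigma> \<phi>[OF t] unfolding integral_curve_def im by simp
    then have "(\<sigma> \<circ> \<phi> has_vector_derivative r t *\<^sub>R xi l1 l2 (\<gamma> t)) (at t within {a..b})"
      using \<phi>[OF t] by (intro vector_diff_chain_within) (simp_all add: has_real_derivative_iff_has_vector_derivative)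
    then show ?thesis
      by (rule has_vector_derivative_transform[OF t, rotated]) (use \<phi> in auto)
  qed
  have \<gamma>_cont: "continuous_on {a..b} \<gamma>"
    using \<gamma>_xi by (metis continuous_on_eq_continuous_within has_vector_derivative_continuous)
  have w_cont: "continuous_on {a..b} w"
    unfolding w_def by (rule xi_velocity_continuous[OF \<gamma>_cont])
  have w0: "w t \<noteq> 0" if "t \<in> {a..b}" for t
    unfolding w_def by (rule xi_velocity_nonzero[OF l conf[OF that]])
  have c: "continuous_on {a..b} (\<lambda>t. (r t * Re (w t), r t * Im (w t)))"
    by (intro continuous_intros r w_cont)
  obtain u :: control where u: "\<And>t. t \<in> {a..b} \<Longrightarrow> apply_bcontfun u t = (r t * Re (w t), r t * Im (w t))"
    using continuous_on_bcontfun_extension[OF c] by blast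
  have vel: "velocity u t = of_real (r t) * w t" if "t \<in> {a..b}" for t
    by (simp add: velocity_def u[OF that] complex_eq_iff)
  have r_xi: "r t *\<^sub>R xi l1 l2 (\<gamma> t) = (r t * Re (w t)) *\<^sub>R v1 l1 l2 (\<gamma> t) + (r t * Im (w t)) *\<^sub>R v2 l1 l2 (\<gamma> t)" for t
    by (simp add: xi_eq w_def scaleR_add_right)
  have traj: "trajectory l1 l2 a b u \<gamma>"
    unfolding trajectory_def using \<gamma>_xi conf by (simp add: u r_xi)
  have "regular_horizontal_curve l1 l2 a b \<gamma>"
    unfolding regular_horizontal_curve_def
  proof (intro exI[of _ "\<lambda>t. r t *\<^sub>R xi l1 l2 (\<gamma> t)"] conjI ballI)
    have "continuous_on {a..b} (\<lambda>t. xi l1 l2 (\<gamma> t))"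
      unfolding xi_def v1_def v2_def d_x1_def d_x2_def d_\<alpha>1_def d_\<alpha>2_def divide_inverse
      by (intro continuous_intros \<gamma>_cont)
    then show "continuous_on {a..b} (\<lambda>t. r t *\<^sub>R xi l1 l2 (\<gamma> t))"
      by (intro continuous_intros r)
    fix t assume t: "t \<in> {a..b}"
    show "\<gamma> t \<in> config_space l1 l2" "(\<gamma> has_vector_derivative r t *\<^sub>R xi l1 l2 (\<gamma> t)) (at t within {a..b})"
      using conf[OF t] \<gamma>_xi[OF t] .
    show "r t *\<^sub>R xi l1 l2 (\<gamma> t) \<in> distribution l1 l2 (\<gamma> t)"
      unfolding distribution_eq_span[OF l conf[OF t]] xi_eq
      by (intro span_mul span_add) (auto intro: span_base)
    have "pos (xi l1 l2 (\<gamma> t)) = w t"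
      unfolding xi_eq frame_combination w_def by simp
    then show "r t *\<^sub>R xi l1 l2 (\<gamma> t) \<noteq> 0"
      using w0[OF t] \<phi>[OF t] by auto
  qed
  moreover have "\<exists>E. (endpoint_map l1 l2 a b (\<gamma> a) has_derivative E) (at u) \<and> range E \<noteq> tangent_space (\<gamma> b)"
  proof (subst singular_trajectory_iff[OF l ab traj])
    show "velocity u t \<noteq> 0" if "t \<in> {a..b}" for t
      using vel[OF that] w0[OF that] \<phi>[OF that] by simp
    show "\<forall>t\<in>{a..b}. velocity u t =
      of_real ((velocity u t \<bullet> xi_velocity l1 l2 (\<gamma> t)) / (norm (xi_velocity l1 l2 (\<gamma> t)))\<^sup>2) * xi_velocity l1 l2 (\<gamma> t)"
      unfolding w_def[symmetric]
    proof
      fix t assume t: "t \<in> {a..b}"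
      have "velocity u t \<bullet> w t = r t * (norm (w t))\<^sup>2"
        unfolding vel[OF t] scaleR_conv_of_real[symmetric] by (simp add: power2_norm_eq_inner)
      then have "(velocity u t \<bullet> w t) / (norm (w t))\<^sup>2 = r t"
        using w0[OF t] by simp
      then show "velocity u t = of_real ((velocity u t \<bullet> w t) / (norm (w t))\<^sup>2) * w t"
        using vel[OF t] by simp
    qed
  qed
  ultimately show "singular_curve l1 l2 a b \<gamma>"
    unfolding singular_curve_def using traj by blast
qed

end
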